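(* Let $m,N$ be positive integers and $\kappa\in\mathbb{C}$. Let $V$ be any $\widehat{\mathfrak{gl}}_m$-module such that for every vector of $V$ there is a degree $i$ such that the subspace $t^{\,i}\,\mathfrak{gl}_m[t]\subset\widehat{\mathfrak{gl}}_m$ annihilates that vector. Let $$W=\mathbb{C}[x_1,x_1^{-1},\ldots,x_N,x_N^{-1}]\otimes(\mathbb{C}^m)^{\otimes N}\otimes V .$$ (i) An action of the trigonometric Cherednik algebra $\mathfrak{C}_N$ (with parameter $\kappa$) on the vector space $W$ is defined as follows: the elements $x_p,x_p^{-1}\in\mathfrak{C}_N$ act via multiplication in $\mathbb{C}[x_1,x_1^{-1},\ldots,x_N,x_N^{-1}]$, the group $\mathfrak{S}_N$ acts by simultaneous permutations of the variables $x_1,\ldots,x_N$ and of the $N$ tensor factors $\mathbb{C}^m$, and the element $z_p$ acts, for $p=1,\ldots,N$, as the operator $$\kappa\,x_p\,\partial_p\otimes\mathrm{id}^{\otimes N}\otimes\mathrm{id}+\sum_{r\neq p}\frac{x_p}{x_p-x_r}(1-\sigma_{pr})\otimes\sigma_{pr}\otimes\mathrm{id}+\sum_{i=0}^\infty\sum_{a,b=1}^m x_p^{-i}\otimes E_{ab}^{(p)}\otimes E_{ba}\,t^{\,i}.$$ (ii) This action of $\mathfrak{C}_N$ on $W$ commutes with the action of the Lie subalgebra $\mathfrak{gl}_m\subset\widehat{\mathfrak{gl}}_m$ on $W$. (iii) If $V$ has level $\kappa-m$ (that is, the central element $C\in\widehat{\mathfrak{gl}}_m$ acts on $V$ as the scalar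 $\kappa-m$), then the action of $\mathfrak{C}_N$ preserves the subspace $\mathfrak{q}\,W\subset W$, where $\mathfrak{q}=t^{-1}\,\mathfrak{sl}_m[t^{-1}]\subset\widehat{\mathfrak{gl}}_m$.
   Context: All algebras and vector spaces are over $\mathbb{C}$. $\mathfrak{S}_N$ is the symmetric group and $\sigma_{pq}$ denotes the transposition of $p$ and $q$. $E_{ab}$ are the standard matrix units, and $E_{ab}^{(p)}$ is the operator on $(\mathbb{C}^m)^{\otimes N}$ acting as $E_{ab}$ in the $p$-th tensor factor and as the identity in the others. Trigonometric Cherednik algebra: $\mathfrak{C}_N$ (depending on $\kappa$) is the associative algebra generated by the Laurent polynomial ring $\mathbb{C}[x_1,x_1^{-1},\ldots,x_N,x_N^{-1}]$, the group algebra $\mathbb{C}\mathfrak{S}_N$ and elements $z_1,\ldots,z_N$ subject to the relations $\sigma x_p\sigma^{-1}=x_{\sigma(p)}$ and $\sigma z_p\sigma^{-1}=z_{\sigma(p)}$ for $\sigma\in\mathfrak{S}_N$; $[z_p,z_q]=\sigma_{pq}(z_p-z_q)$ for $p\ne q$; $[z_p,x_q]=-x_p\sigma_{pq}$ for $q\neq p$; and $[z_p,x_p]=\kappa x_p+\sum_{r\neq p}x_p\sigma_{pr}$. Affine Lie algebra: $\widehat{\mathfrak{gl}}_m$ is the central extension of $\mathfrak{gl}_m[t,t^{-1}]$ by the one-dimensional space $\mathbb{C}C$, with $C$ central and $$[E_{ab}t^{\,i},E_{cd}t^{\,j}]=(\delta_{bc}E_{ad}-\delta_{ad}E_{cb})\,t^{\,i+j}+i\,\delta_{i,-j}\,\delta_{ad}\,\delta_{bc}\,C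 .$$ The subspaces $\mathfrak{gl}_m$ (degree zero in $t$) and $\mathfrak{q}=t^{-1}\mathfrak{sl}_m[t^{-1}]$ are Lie subalgebras. The space $\mathbb{C}[x_1^{\pm1},\ldots,x_N^{\pm1}]\otimes(\mathbb{C}^m)^{\otimes N}$ is identified with $\mathbb{C}^m[t,t^{-1}]^{\otimes N}$, a $\widehat{\mathfrak{gl}}_m$-module on which $C$ acts as zero, and $W$ is the tensor product $\widehat{\mathfrak{gl}}_m$-module with $V$: $E_{cd}t^{\,j}$ acts on $W$ as $\sum_{q=1}^N x_q^{\,j}\otimes E_{cd}^{(q)}\otimes\mathrm{id}+\mathrm{id}\otimes\mathrm{id}^{\otimes N}\otimes E_{cd}t^{\,j}$. $\mathfrak{q}W$ is the span of all $Pw$ with $P\in\mathfrak{q}$, $w\in W$. In the operator in (i): $\partial_p=\partial/\partial x_p$; in the middle summands the left $\sigma_{pr}$ permutes the variables $x_p,x_r$ in Laurent polynomials and the right $\sigma_{pr}$ permutes the $p$-th and $r$-th tensor factors $\mathbb{C}^m$; the infinite sum is well defined on $W$ because of the annihilation condition on $V$. *)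

theory Defs
  imports
    Complex_Main
    "HOL-Library.Cardinality"
    "HOL-Library.Poly_Mapping"
    "HOL-Combinatorics.Perm"
    "HOL-Algebra.QuotRing"
begin

unbundle permutation_syntax

text \<open>
  The numbers N and m are the cardinalities of the finite types 'n and 'm, which index the variables
  and tensor factors, and the standard basis of the m-dimensional space, respectively. The symmetric
  group is the group 'n perm. A vector space with a given basis is modelled by the finitely supported
  functions on that basis.
\<close>

definition lin_ext ::
  "('k \<Rightarrow> 'a::zero \<Rightarrow> 'b::comm_monoid_add) \<Rightarrow> ('k \<Rightarrow>\<^sub>0 'a) \<Rightarrow> 'b"
  where "lin_ext g f = (\<Sum>k\<in>Poly_Mapping.keys f. g k (Poly_Mapping.lookup f k))"

text \<open>Coefficientwise scalar multiplication; \<open>s\<close> is the scalar multiplication of the coefficients.\<close>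

definition pm_scale ::
  "(complex \<Rightarrow> 'a \<Rightarrow> 'a) \<Rightarrow> complex \<Rightarrow> ('k \<Rightarrow>\<^sub>0 'a::zero) \<Rightarrow> ('k \<Rightarrow>\<^sub>0 'a)"
  where "pm_scale s c = Poly_Mapping.map (s c)"

lemma lookup_pm_scale:
  assumes "s c 0 = 0"
  shows "Poly_Mapping.lookup (pm_scale s c f) k = s c (Poly_Mapping.lookup f k)"
  using assms by (simp add: pm_scale_def map.rep_eq when_def)

lemma lin_ext_zero [simp]: "lin_ext g 0 = 0"
  by (simp add: lin_ext_def)

lemma lin_ext_single [simp]:
  assumes "g k 0 = 0"
  shows "lin_ext g (Poly_Mapping.single k c) = g k c"
  using assms by (cases "c = 0") (simp_all add: lin_ext_def)

lemma lin_ext_superset: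
  assumes "finite S" "Poly_Mapping.keys f \<subseteq> S" "\<And>k. g k 0 = 0"
  shows "lin_ext g f = (\<Sum>k\<in>S. g k (Poly_Mapping.lookup f k))"
  unfolding lin_ext_def
  by (rule sum.mono_neutral_left) (use assms in \<open>auto simp: in_keys_iff\<close>)

lemma lin_ext_add:
  fixes g :: "'k \<Rightarrow> 'a::comm_monoid_add \<Rightarrow> 'b::comm_monoid_add"
  assumes "\<And>k. g k 0 = 0" "\<And>k x y. g k (x + y) = g k x + g k y"
  shows "lin_ext g (f1 + f2) = lin_ext g f1 + lin_ext g f2"
proof -
  let ?S = "Poly_Mapping.keys f1 \<union> Poly_Mapping.keys f2"
  have "Poly_Mapping.keys (f1 + f2) \<subseteq> ?S"
    by (rule keys_add)
  then show ?thesis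
    using assms
    by (simp add: lin_ext_superset[of ?S] lookup_add sum.distrib)
qed

lemma poly_mapping_expansion:
  fixes f :: "'k \<Rightarrow>\<^sub>0 'a::comm_monoid_add"
  shows "f = (\<Sum>k\<in>Poly_Mapping.keys f. Poly_Mapping.single k (Poly_Mapping.lookup f k))"
proof (rule poly_mapping_eqI)
  fix j
  show "Poly_Mapping.lookup f j =
    Poly_Mapping.lookup (\<Sum>k\<in>Poly_Mapping.keys f. Poly_Mapping.single k (Poly_Mapping.lookup f k)) j"
    by (simp add: lookup_sum lookup_single when_def sum.delta in_keys_iff)
qed

lemma poly_mapping_add_induct [case_names zero add]:
  fixes f :: "'k \<Rightarrow>\<^sub>0 'a::comm_monoid_add"
  assumes "P 0" "\<And>k c h. P h \<Longrightarrow> P (Poly_Mapping.single k c + h)"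
  shows "P f"
proof -
  have "P (\<Sum>k\<in>S. Poly_Mapping.single k (Poly_Mapping.lookup f k))" if "finite S" for S
    using that by (induction S) (simp_all add: assms)
  from this[OF finite_keys[of f]] show ?thesis
    by (subst poly_mapping_expansion)
qed


section \<open>Laurent polynomials\<close>

text \<open>The key of a monomial is its exponent vector; the product of the ring is convolution.\<close>

type_synonym 'n laurent = "('n \<Rightarrow>\<^sub>0 int) \<Rightarrow>\<^sub>0 complex"

definition xpow :: "'n \<Rightarrow> int \<Rightarrow> 'n laurent"
  where "xpow p i = Poly_Mapping.single (Poly_Mapping.single p i) 1"

definition perm_exponent :: "'n perm \<Rightarrow> ('n \<Rightarrow>\<^sub>0 int) \<Rightarrow> ('n \<Rightarrow>\<^sub>0 int)"
  where "perm_exponent \<sigma> k = Poly_Mapping.map_key (\<lambda>q. inverse \<sigma> \<langle>$\<rangle> q) k"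

definition perm_vars :: "'n perm \<Rightarrow> 'n laurent \<Rightarrow> 'n laurent"
  where "perm_vars \<sigma> = lin_ext (\<lambda>k c. Poly_Mapping.single (perm_exponent \<sigma> k) c)"

definition partial_deriv :: "'n \<Rightarrow> 'n laurent \<Rightarrow> 'n laurent"
  where "partial_deriv p = lin_ext (\<lambda>k c.
    Poly_Mapping.single (k - Poly_Mapping.single p 1) (of_int (Poly_Mapping.lookup k p) * c))"

text \<open>
  The operator \<open>x\<^sub>p / (x\<^sub>p - x\<^sub>r) (1 - \<sigma>\<^sub>p\<^sub>r)\<close>. For distinct \<open>p\<close> and \<open>r\<close> the quotient exists and is
  unique, see \<open>divided_difference_ex1\<close> below.
\<close>

definition divided_difference :: "'n \<Rightarrow> 'n \<Rightarrow> 'n laurent \<Rightarrow> 'n laurent"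
  where "divided_difference p r f =
    (THE g. (xpow p 1 - xpow r 1) * g = xpow p 1 * (f - perm_vars \<langle>p \<leftrightarrow> r\<rangle> f))"

lemma xpow_mult: "xpow p i * xpow p j = xpow p (i + j)"
  by (simp add: xpow_def mult_single flip: single_add)

lemma xpow_power: "xpow p (int n) = xpow p 1 ^ n"
proof (induction n)
  case 0
  then show ?case by (simp add: xpow_def)
next
  case (Suc n)
  then show ?case by (simp flip: xpow_mult)
qed

lemma dvd_xpow_diff:
  "xpow p 1 - xpow r 1 dvd xpow p (int n) - xpow r (int n)"
  unfolding xpow_power by (simp add: dvd_def) (metis power_diff_sumr2)

lemma lookup_perm_exponent [simp]:
  "Poly_Mapping.lookup (perm_exponent \<sigma> k) q = Poly_Mapping.lookup k (inverse \<sigma> \<langle>$\<rangle> q)"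
proof -
  have "inj (\<lambda>q. inverse \<sigma> \<langle>$\<rangle> q)"
    by (rule bij_is_inj) simp
  then show ?thesis
    by (simp add: perm_exponent_def map_key.rep_eq)
qed

lemma lookup_perm_exponent_swap:
  assumes "p \<noteq> r"
  shows "Poly_Mapping.lookup (perm_exponent \<langle>p \<leftrightarrow> r\<rangle> k) q =
    Poly_Mapping.lookup k (if q = p then r else if q = r then p else q)"
  by simp

lemma dvd_monomial_diff:
  assumes "p \<noteq> r"
  shows "xpow p 1 - xpow r 1 dvd
    Poly_Mapping.single k c - Poly_Mapping.single (perm_exponent \<langle>p \<leftrightarrow> r\<rangle> k) c"
proof -
  have main: "xpow p 1 - xpow r 1 dvd
      Poly_Mapping.single k c - Poly_Mapping.single (perm_exponent \<langle>p \<leftrightarrow> r\<rangle> k) c"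
    if "p \<noteq> r" "Poly_Mapping.lookup k r \<le> Poly_Mapping.lookup k p" for p r :: 'a and k
  proof -
    define n where "n = nat (Poly_Mapping.lookup k p - Poly_Mapping.lookup k r)"
    define l where "l = k - Poly_Mapping.single p (int n)"
    have k: "k = l + Poly_Mapping.single p (int n)"
      by (simp add: l_def)
    have sk: "perm_exponent \<langle>p \<leftrightarrow> r\<rangle> k = l + Poly_Mapping.single r (int n)"
      by (rule poly_mapping_eqI)
        (use that in \<open>auto simp: lookup_perm_exponent_swap l_def n_def lookup_add lookup_minus
          lookup_single when_def\<close>)
    have "Poly_Mapping.single k c - Poly_Mapping.single (perm_exponent \<langle>p \<leftrightarrow> r\<rangle> k) c =
      Poly_Mapping.single l c * (xpow p (int n) - xpow r (int n))"
      unfolding sk by (subst k) (simp add: xpow_def mult_single algebra_simps)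
    then show ?thesis
      using dvd_xpow_diff[of p r n] by simp
  qed
  show ?thesis
  proof (cases "Poly_Mapping.lookup k r \<le> Poly_Mapping.lookup k p")
    case True
    then show ?thesis by (rule main[OF assms])
  next
    case False
    have "\<langle>r \<leftrightarrow> p\<rangle> = \<langle>p \<leftrightarrow> r\<rangle>"
      by (rule perm_eqI) (metis apply_swap_eq_iff swap_sym)
    then have "xpow r 1 - xpow p 1 dvd
        Poly_Mapping.single k c - Poly_Mapping.single (perm_exponent \<langle>p \<leftrightarrow> r\<rangle> k) c"
      using main[of r p k] False assms by simp
    then show ?thesis
      by (metis minus_diff_eq minus_dvd_iff)
  qed
qed

lemma xpow_diff_cancel:
  assumes "p \<noteq> r" "(xpow p 1 - xpow r 1) * g = 0"
  shows "g = 0"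
proof (rule ccontr)
  assume "g \<noteq> 0"
  then obtain k where k: "Poly_Mapping.lookup g k \<noteq> 0"
    by (metis lookup_zero poly_mapping_eqI)
  have shift: "Poly_Mapping.lookup (xpow q 1 * g) j =
      Poly_Mapping.lookup g (j - Poly_Mapping.single q 1)" for q j
  proof (induction g rule: poly_mapping_add_induct)
    case zero
    then show ?case by simp
  next
    case (add k c h)
    then show ?case
      by (auto simp: distrib_left lookup_add xpow_def mult_single lookup_single when_def)
  qed
  define d where "d = Poly_Mapping.single p (1::int) - Poly_Mapping.single r 1"
  have step: "Poly_Mapping.lookup g (j + d) = Poly_Mapping.lookup g j" for j
  proof -
    have "xpow p 1 * g = xpow r 1 * g"
      using assms(2) by (simp add: algebra_simps)
    then have "Poly_Mapping.lookup (xpow p 1 * g) (j + Poly_Mapping.single p 1) =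
        Poly_Mapping.lookup (xpow r 1 * g) (j + Poly_Mapping.single p 1)"
      by simp
    then show ?thesis
      unfolding shift by (simp add: d_def algebra_simps)
  qed
  define e where "e n = k + Poly_Mapping.single p (int n) - Poly_Mapping.single r (int n)" for n
  have "Poly_Mapping.lookup g (e n) \<noteq> 0" for n
  proof (induction n)
    case 0
    then show ?case using k by (simp add: e_def)
  next
    case (Suc n)
    have "e (Suc n) = e n + d"
      by (simp add: e_def d_def single_add algebra_simps)
    with Suc show ?case by (simp add: step)
  qed
  then have "range e \<subseteq> Poly_Mapping.keys g"
    by (auto simp: in_keys_iff)
  moreover have "inj e"
  proof (rule injI)
    fix i j
    assume "e i = e j"
    then have "Poly_Mapping.lookup (e i) p = Poly_Mapping.lookup (e j) p"
      by simp
    then show "i = j"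
      using assms(1) by (simp add: e_def lookup_add lookup_minus lookup_single when_def)
  qed
  ultimately show False
    using finite_subset[OF _ finite_keys] finite_imageD infinite_UNIV_nat by metis
qed

lemma divided_difference_ex1:
  assumes "p \<noteq> r"
  shows "\<exists>!g. (xpow p 1 - xpow r 1) * g = xpow p 1 * (f - perm_vars \<langle>p \<leftrightarrow> r\<rangle> f)"
proof (rule ex_ex1I)
  have "xpow p 1 - xpow r 1 dvd f - perm_vars \<langle>p \<leftrightarrow> r\<rangle> f"
  proof (induction f rule: poly_mapping_add_induct)
    case zero
    then show ?case by (simp add: perm_vars_def)
  next
    case (add k c h)
    have "Poly_Mapping.single k c + h - perm_vars \<langle>p \<leftrightarrow> r\<rangle> (Poly_Mapping.single k c + h) =
      (Poly_Mapping.single k c - Poly_Mapping.single (perm_exponent \<langle>p \<leftrightarrow> r\<rangle> k) c) +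
      (h - perm_vars \<langle>p \<leftrightarrow> r\<rangle> h)"
      by (simp add: perm_vars_def lin_ext_add single_add)
    with add dvd_monomial_diff[OF assms] show ?case
      by (simp only: dvd_add)
  qed
  then obtain h where "f - perm_vars \<langle>p \<leftrightarrow> r\<rangle> f = (xpow p 1 - xpow r 1) * h" ..
  then have "(xpow p 1 - xpow r 1) * (xpow p 1 * h) = xpow p 1 * (f - perm_vars \<langle>p \<leftrightarrow> r\<rangle> f)"
    by (simp add: mult.left_commute)
  then show "\<exists>g. (xpow p 1 - xpow r 1) * g = xpow p 1 * (f - perm_vars \<langle>p \<leftrightarrow> r\<rangle> f)" ..
next
  fix g h
  assume "(xpow p 1 - xpow r 1) * g = xpow p 1 * (f - perm_vars \<langle>p \<leftrightarrow> r\<rangle> f)"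
    and "(xpow p 1 - xpow r 1) * h = xpow p 1 * (f - perm_vars \<langle>p \<leftrightarrow> r\<rangle> f)"
  then have "(xpow p 1 - xpow r 1) * (g - h) = 0"
    by (simp add: right_diff_distrib)
  then show "g = h"
    using xpow_diff_cancel[OF assms] by fastforce
qed


section \<open>The tensor power\<close>

text \<open>
  The key \<open>s\<close> stands for the tensor product of the standard basis vectors \<open>e (s p)\<close> over all \<open>p\<close>. A
  permutation moves the \<open>p\<close>-th factor to the position \<open>\<sigma> p\<close>.
\<close>

type_synonym ('n, 'm) tpower = "('n \<Rightarrow> 'm) \<Rightarrow>\<^sub>0 complex"

definition perm_factors :: "'n perm \<Rightarrow> ('n, 'm) tpower \<Rightarrow> ('n, 'm) tpower"
  where "perm_factors \<sigma> = lin_ext (\<lambda>s c. Poly_Mapping.single (\<lambda>q. s (inverse \<sigma> \<langle>$\<rangle> q)) c)"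

definition E_at :: "'m \<Rightarrow> 'm \<Rightarrow> 'n \<Rightarrow> ('n, 'm) tpower \<Rightarrow> ('n, 'm) tpower"
  where "E_at a b p = lin_ext (\<lambda>s c. if s p = b then Poly_Mapping.single (s(p := a)) c else 0)"


section \<open>The space W\<close>

text \<open>
  The first two tensor factors have bases indexed by the exponent vectors and the multi-indices, so
  that the tensor product with the space \<open>'v\<close> is the space of finitely supported functions with
  values in \<open>'v\<close>. The scalar multiplication of \<open>'v\<close> is the parameter \<open>sc\<close>.
\<close>

type_synonym ('n, 'm, 'v) W = "(('n \<Rightarrow>\<^sub>0 int) \<times> ('n \<Rightarrow> 'm)) \<Rightarrow>\<^sub>0 'v"

definition pure_tensor ::
  "(complex \<Rightarrow> 'v \<Rightarrow> 'v) \<Rightarrow> 'n laurent \<Rightarrow> ('n, 'm) tpower \<Rightarrow> 'v::ab_group_add \<Rightarrow> ('n, 'm, 'v) W"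
  where "pure_tensor sc f u v =
    lin_ext (\<lambda>k c. lin_ext (\<lambda>s d. Poly_Mapping.single (k, s) (sc (c * d) v)) u) f"

text \<open>
  The tensor product of three linear operators; it is given on pure tensors by the usual formula, see
  \<open>op_tensor_pure_tensor\<close> below.
\<close>

definition op_tensor ::
  "(complex \<Rightarrow> 'v \<Rightarrow> 'v) \<Rightarrow> ('n laurent \<Rightarrow> 'n laurent) \<Rightarrow> (('n, 'm) tpower \<Rightarrow> ('n, 'm) tpower) \<Rightarrow>
    ('v \<Rightarrow> 'v) \<Rightarrow> ('n, 'm, 'v::ab_group_add) W \<Rightarrow> ('n, 'm, 'v) W"
  where "op_tensor sc A B D =
    lin_ext (\<lambda>(k, s) v.
      pure_tensor sc (A (Poly_Mapping.single k 1)) (B (Poly_Mapping.single s 1)) (D v))"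

context
  fixes sc :: "complex \<Rightarrow> 'v::ab_group_add \<Rightarrow> 'v"
  assumes sc: "vector_space sc"
begin

interpretation vector_space sc
  by (rule sc)

lemma pure_tensor_add_left:
  "pure_tensor sc (f1 + f2) u v = pure_tensor sc f1 u v + pure_tensor sc f2 u v"
  unfolding pure_tensor_def
  by (rule lin_ext_add)
    (auto simp: lin_ext_def scale_left_distrib distrib_right single_add sum.distrib)

lemma pure_tensor_add_middle:
  fixes f :: "'n laurent"
  shows "pure_tensor sc f (u1 + u2) v = pure_tensor sc f u1 v + pure_tensor sc f u2 v"
proof -
  have "lin_ext (\<lambda>s d. Poly_Mapping.single (k, s) (sc (c * d) v)) (u1 + u2) =
      lin_ext (\<lambda>s d. Poly_Mapping.single (k, s) (sc (c * d) v)) u1 +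
      lin_ext (\<lambda>s d. Poly_Mapping.single (k, s) (sc (c * d) v)) u2"
    for k :: "'n \<Rightarrow>\<^sub>0 int" and c
    by (rule lin_ext_add) (auto simp: scale_left_distrib distrib_left single_add)
  then show ?thesis
    unfolding pure_tensor_def lin_ext_def[of _ f] by (simp only: sum.distrib)
qed

lemma pure_tensor_zero [simp]: "pure_tensor sc 0 u v = 0" "pure_tensor sc f 0 v = 0"
    "pure_tensor sc f u 0 = 0"
  by (simp_all add: pure_tensor_def lin_ext_def)

lemma pure_tensor_add_right:
  "pure_tensor sc f u (v1 + v2) = pure_tensor sc f u v1 + pure_tensor sc f u v2"
  by (simp add: pure_tensor_def lin_ext_def scale_right_distrib single_add sum.distrib)

lemma pure_tensor_single:
  "pure_tensor sc (Poly_Mapping.single k c) (Poly_Mapping.single s d) v =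
    Poly_Mapping.single (k, s) (sc (c * d) v)"
  by (simp add: pure_tensor_def)

lemma pm_scale_single: "pm_scale (*) c (Poly_Mapping.single k d) = Poly_Mapping.single k (c * d)"
  by (simp add: pm_scale_def)

lemma pm_scale_zero: "pm_scale (*) c 0 = 0"
  by (rule poly_mapping_eqI) (simp add: lookup_pm_scale)

lemma pm_scale_add: "pm_scale (*) c (f + g) = pm_scale (*) c f + pm_scale (*) c g"
  by (rule poly_mapping_eqI)
    (simp add: lookup_pm_scale lookup_add algebra_simps)

lemma pure_tensor_scale_left: "pure_tensor sc (pm_scale (*) c f) u v = pure_tensor sc f u (sc c v)"
proof (induction f rule: poly_mapping_add_induct)
  case zero
  then show ?case by (simp add: pm_scale_zero)
next
  case (add k a h)
  have "pure_tensor sc (Poly_Mapping.single k (c * a)) u v =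
      pure_tensor sc (Poly_Mapping.single k a) u (sc c v)"
    by (simp add: pure_tensor_def lin_ext_def mult_ac)
  with add show ?case
    by (simp add: pm_scale_add pm_scale_single pure_tensor_add_left)
qed

lemma pure_tensor_scale_middle: "pure_tensor sc f (pm_scale (*) c u) v = pure_tensor sc f u (sc c v)"
proof (induction u rule: poly_mapping_add_induct)
  case zero
  then show ?case by (simp add: pm_scale_zero)
next
  case (add s a h)
  have "pure_tensor sc f (Poly_Mapping.single s (c * a)) v =
      pure_tensor sc f (Poly_Mapping.single s a) (sc c v)"
    by (simp add: pure_tensor_def lin_ext_def mult_ac)
  with add show ?case
    by (simp add: pm_scale_add pm_scale_single pure_tensor_add_middle)
qed

lemma op_tensor_pure_tensor:
  assumes "Vector_Spaces.linear (pm_scale (*)) (pm_scale (*)) A"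
    and "Vector_Spaces.linear (pm_scale (*)) (pm_scale (*)) B"
    and "Vector_Spaces.linear sc sc D"
  shows "op_tensor sc A B D (pure_tensor sc f u v) = pure_tensor sc (A f) (B u) (D v)"
proof -
  interpret A: Vector_Spaces.linear "pm_scale (*)" "pm_scale (*)" A by fact
  interpret B: Vector_Spaces.linear "pm_scale (*)" "pm_scale (*)" B by fact
  interpret D: Vector_Spaces.linear sc sc D by fact
  have op_add: "op_tensor sc A B D (w1 + w2) = op_tensor sc A B D w1 + op_tensor sc A B D w2"
    for w1 w2
    unfolding op_tensor_def
    by (rule lin_ext_add) (auto simp: D.zero D.add pure_tensor_add_right)
  have op_zero: "op_tensor sc A B D 0 = 0"
    by (simp add: op_tensor_def)
  have base: "op_tensor sc A B D
      (pure_tensor sc (Poly_Mapping.single k c) (Poly_Mapping.single s d) v) =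
      pure_tensor sc (A (Poly_Mapping.single k c)) (B (Poly_Mapping.single s d)) (D v)" for k c s d
  proof -
    have "Poly_Mapping.single k c = pm_scale (*) c (Poly_Mapping.single k 1)"
      "Poly_Mapping.single s d = pm_scale (*) d (Poly_Mapping.single s 1)"
      by (simp_all add: pm_scale_single)
    then have "pure_tensor sc (A (Poly_Mapping.single k c)) (B (Poly_Mapping.single s d)) (D v) =
        pure_tensor sc (A (Poly_Mapping.single k 1)) (B (Poly_Mapping.single s 1))
          (sc (c * d) (D v))"
      by (simp only: A.scale B.scale pure_tensor_scale_left pure_tensor_scale_middle scale_scale
          mult.commute)
    then show ?thesis
      by (simp add: pure_tensor_single op_tensor_def D.zero D.scale)
  qed
  have one: "op_tensor sc A B D (pure_tensor sc (Poly_Mapping.single k c) u v) =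
      pure_tensor sc (A (Poly_Mapping.single k c)) (B u) (D v)" for k c
    by (induction u rule: poly_mapping_add_induct)
      (simp_all add: op_zero B.zero B.add op_add base pure_tensor_add_middle)
  show ?thesis
    by (induction f rule: poly_mapping_add_induct)
      (simp_all add: op_zero A.zero A.add op_add one pure_tensor_add_left)
qed

end


section \<open>The affine Lie algebra and its modules\<close>

text \<open>\<open>Et a b i\<close> is the basis element \<open>E\<^sub>a\<^sub>b t\<^sup>i\<close>, and \<open>Cen\<close> is the central element \<open>C\<close>.\<close>

datatype 'm affine_basis = Et 'm 'm int | Cen

type_synonym 'm affine_gl = "'m affine_basis \<Rightarrow>\<^sub>0 complex"

abbreviation basis_elt :: "'m affine_basis \<Rightarrow> 'm affine_gl"
  where "basis_elt g \<equiv> Poly_Mapping.single g 1"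

fun basis_bracket :: "'m affine_basis \<Rightarrow> 'm affine_basis \<Rightarrow> 'm affine_gl"
  where
    "basis_bracket (Et a b i) (Et c d j) =
      (if b = c then basis_elt (Et a d (i + j)) else 0)
      - (if a = d then basis_elt (Et c b (i + j)) else 0)
      + (if i = - j \<and> a = d \<and> b = c then Poly_Mapping.single Cen (of_int i) else 0)"
  | "basis_bracket (Et a b i) Cen = 0"
  | "basis_bracket Cen h = 0"

definition affine_bracket :: "'m affine_gl \<Rightarrow> 'm affine_gl \<Rightarrow> 'm affine_gl"
  where "affine_bracket X Y =
    lin_ext (\<lambda>g c. lin_ext (\<lambda>h d. pm_scale (*) (c * d) (basis_bracket g h)) Y) X"

definition affine_module ::
  "(complex \<Rightarrow> 'v \<Rightarrow> 'v) \<Rightarrow> ('m affine_gl \<Rightarrow> 'v \<Rightarrow> 'v::ab_group_add) \<Rightarrow> bool"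
  where "affine_module sc \<pi> \<longleftrightarrow>
    vector_space sc \<and>
    (\<forall>X. Vector_Spaces.linear sc sc (\<pi> X)) \<and>
    (\<forall>v. Vector_Spaces.linear (pm_scale (*)) sc (\<lambda>X. \<pi> X v)) \<and>
    (\<forall>X Y v. \<pi> (affine_bracket X Y) v = \<pi> X (\<pi> Y v) - \<pi> Y (\<pi> X v))"

text \<open>The subspace \<open>t\<^sup>i gl\<^sub>m[t]\<close>, for any integer \<open>i\<close>.\<close>

definition gl_degree_ge :: "int \<Rightarrow> 'm affine_gl set"
  where "gl_degree_ge i = {X. Poly_Mapping.keys X \<subseteq> {Et a b j |a b j. i \<le> j}}"

definition gl_finite :: "'m affine_gl set"
  where "gl_finite = {X. Poly_Mapping.keys X \<subseteq> {Et a b 0 |a b. True}}"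

text \<open>The subalgebra \<open>t\<^sup>-\<^sup>1 sl\<^sub>m[t\<^sup>-\<^sup>1]\<close>: the coefficient of each power of \<open>t\<close> has zero trace.\<close>

definition q_minus :: "'m::finite affine_gl set"
  where "q_minus = {X. Poly_Mapping.keys X \<subseteq> {Et a b j |a b j. j \<le> - 1} \<and>
    (\<forall>j. (\<Sum>a\<in>UNIV. Poly_Mapping.lookup X (Et a a j)) = 0)}"

fun W_basis_act ::
  "(complex \<Rightarrow> 'v \<Rightarrow> 'v) \<Rightarrow> ('m affine_gl \<Rightarrow> 'v \<Rightarrow> 'v) \<Rightarrow> 'm affine_basis \<Rightarrow>
    ('n::finite, 'm, 'v::ab_group_add) W \<Rightarrow> ('n, 'm, 'v) W"
  where
    "W_basis_act sc \<pi> (Et c d j) w =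
      (\<Sum>q\<in>UNIV. op_tensor sc (\<lambda>f. xpow q j * f) (E_at c d q) id w)
      + op_tensor sc id id (\<pi> (basis_elt (Et c d j))) w"
  | "W_basis_act sc \<pi> Cen w = op_tensor sc id id (\<pi> (basis_elt Cen)) w"

definition W_act ::
  "(complex \<Rightarrow> 'v \<Rightarrow> 'v) \<Rightarrow> ('m affine_gl \<Rightarrow> 'v \<Rightarrow> 'v) \<Rightarrow> 'm affine_gl \<Rightarrow>
    ('n::finite, 'm, 'v::ab_group_add) W \<Rightarrow> ('n, 'm, 'v) W"
  where "W_act sc \<pi> X w = lin_ext (\<lambda>g c. pm_scale sc c (W_basis_act sc \<pi> g w)) X"

definition qW ::
  "(complex \<Rightarrow> 'v \<Rightarrow> 'v) \<Rightarrow> ('m affine_gl \<Rightarrow> 'v \<Rightarrow> 'v) \<Rightarrow>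
    ('n::finite, 'm::finite, 'v::ab_group_add) W set"
  where "qW sc \<pi> = module.span (pm_scale sc) {W_act sc \<pi> P w |P w. P \<in> q_minus}"


section \<open>The trigonometric Cherednik algebra\<close>

datatype 'g free_word = Word (letters: "'g list")

instantiation free_word :: (type) monoid_add
begin

definition zero_free_word :: "'a free_word"
  where "0 = Word []"

definition plus_free_word :: "'a free_word \<Rightarrow> 'a free_word \<Rightarrow> 'a free_word"
  where "u + v = Word (letters u @ letters v)"

instance
  by standard (simp_all add: zero_free_word_def plus_free_word_def)

end

text \<open>The free associative algebra is the monoid algebra of the monoid of words.\<close>

type_synonym 'g free_algebra = "'g free_word \<Rightarrow>\<^sub>0 complex"

abbreviation generator :: "'g \<Rightarrow> 'g free_algebra"
  where "generator g \<equiv> Poly_Mapping.single (Word [g]) 1"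

abbreviation scalar :: "complex \<Rightarrow> 'g free_algebra"
  where "scalar c \<equiv> Poly_Mapping.single 0 c"

definition free_algebra_ring :: "'g free_algebra ring"
  where "free_algebra_ring = \<lparr>carrier = UNIV, monoid.mult = (*), one = 1, zero = 0, add = (+)\<rparr>"

lemma free_algebra_ring_is_ring: "ring free_algebra_ring"
proof (intro ringI abelian_groupI monoidI, goal_cases)
  case (6 x)
  then show ?case
    by (intro bexI[of _ "- x"]) (auto simp: free_algebra_ring_def)
qed (auto simp: free_algebra_ring_def algebra_simps)

datatype 'n cherednik_gen = Gen_x 'n | Gen_xinv 'n | Gen_s "'n perm" | Gen_z 'n

abbreviation "gx p \<equiv> generator (Gen_x p)"
abbreviation "gxi p \<equiv> generator (Gen_xinv p)"
abbreviation "gs \<sigma> \<equiv> generator (Gen_s \<sigma>)"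
abbreviation "gz p \<equiv> generator (Gen_z p)"

text \<open>
  A relation \<open>a = b\<close> is encoded by the element \<open>a - b\<close>. The first five lines present the Laurent
  polynomial ring and the group algebra.
\<close>

definition cherednik_relations :: "complex \<Rightarrow> 'n::finite cherednik_gen free_algebra set"
  where "cherednik_relations \<kappa> =
    {gx p * gxi p - 1 |p. True} \<union>
    {gxi p * gx p - 1 |p. True} \<union>
    {gx p * gx q - gx q * gx p |p q. True} \<union>
    {gs \<sigma> * gs \<tau> - gs (\<sigma> * \<tau>) |\<sigma> \<tau>. True} \<union>
    {gs 1 - 1} \<union>
    {gs \<sigma> * gx p * gs (inverse \<sigma>) - gx (\<sigma> \<langle>$\<rangle> p) |\<sigma> p. True} \<union>
    {gs \<sigma> * gz p * gs (inverse \<sigma>) - gz (\<sigma> \<langle>$\<rangle> p) |\<sigma> p. True} \<union>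
    {(gz p * gz q - gz q * gz p) - gs \<langle>p \<leftrightarrow> q\<rangle> * (gz p - gz q) |p q. p \<noteq> q} \<union>
    {(gz p * gx q - gx q * gz p) - (- (gx p * gs \<langle>p \<leftrightarrow> q\<rangle>)) |p q. q \<noteq> p} \<union>
    {(gz p * gx p - gx p * gz p)
      - (scalar \<kappa> * gx p + (\<Sum>r\<in>UNIV - {p}. gx p * gs \<langle>p \<leftrightarrow> r\<rangle>)) |p. True}"

definition cherednik_ideal :: "complex \<Rightarrow> 'n::finite cherednik_gen free_algebra set"
  where "cherednik_ideal \<kappa> = genideal free_algebra_ring (cherednik_relations \<kappa>)"

definition cherednik_algebra :: "complex \<Rightarrow> 'n::finite cherednik_gen free_algebra set ring"
  where "cherednik_algebra \<kappa> = free_algebra_ring Quot cherednik_ideal \<kappa>"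

definition cherednik_class ::
  "complex \<Rightarrow> 'n::finite cherednik_gen free_algebra \<Rightarrow> 'n cherednik_gen free_algebra set"
  where "cherednik_class \<kappa> a = cherednik_ideal \<kappa> +>\<^bsub>free_algebra_ring\<^esub> a"

text \<open>
  An action on a vector space with scalar multiplication \<open>s\<close> is a unital homomorphism of complex
  algebras to the algebra of linear operators.
\<close>

definition cherednik_action ::
  "complex \<Rightarrow> (complex \<Rightarrow> 'w \<Rightarrow> 'w) \<Rightarrow>
    ('n::finite cherednik_gen free_algebra set \<Rightarrow> 'w \<Rightarrow> 'w::ab_group_add) \<Rightarrow> bool"
  where "cherednik_action \<kappa> s \<rho> \<longleftrightarrow>
    (\<forall>c\<in>carrier (cherednik_algebra \<kappa>). Vector_Spaces.linear s s (\<rho> c)) \<and>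
    \<rho> \<one>\<^bsub>cherednik_algebra \<kappa>\<^esub> = id \<and>
    (\<forall>c\<in>carrier (cherednik_algebra \<kappa>). \<forall>d\<in>carrier (cherednik_algebra \<kappa>).
      \<rho> (c \<otimes>\<^bsub>cherednik_algebra \<kappa>\<^esub> d) = \<rho> c \<circ> \<rho> d \<and>
      \<rho> (c \<oplus>\<^bsub>cherednik_algebra \<kappa>\<^esub> d) = (\<lambda>w. \<rho> c w + \<rho> d w)) \<and>
    (\<forall>a. \<rho> (cherednik_class \<kappa> (scalar a)) = s a)"


section \<open>The operators on W\<close>

definition z_summand ::
  "(complex \<Rightarrow> 'v \<Rightarrow> 'v) \<Rightarrow> ('m affine_gl \<Rightarrow> 'v \<Rightarrow> 'v) \<Rightarrow> 'n \<Rightarrow> nat \<Rightarrow>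
    ('n::finite, 'm::finite, 'v::ab_group_add) W \<Rightarrow> ('n, 'm, 'v) W"
  where "z_summand sc \<pi> p i w =
    (\<Sum>a\<in>UNIV. \<Sum>b\<in>UNIV.
      op_tensor sc (\<lambda>f. xpow p (- int i) * f) (E_at a b p) (\<pi> (basis_elt (Et b a (int i)))) w)"

text \<open>
  \<open>Sum_any\<close> is the sum of the nonzero terms, provided that there are only finitely many of them.
\<close>

definition z_operator ::
  "complex \<Rightarrow> (complex \<Rightarrow> 'v \<Rightarrow> 'v) \<Rightarrow> ('m affine_gl \<Rightarrow> 'v \<Rightarrow> 'v) \<Rightarrow> 'n \<Rightarrow>
    ('n::finite, 'm::finite, 'v::ab_group_add) W \<Rightarrow> ('n, 'm, 'v) W"
  where "z_operator \<kappa> sc \<pi> p w =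
    pm_scale sc \<kappa> (op_tensor sc (\<lambda>f. xpow p 1 * partial_deriv p f) id id w)
    + (\<Sum>r\<in>UNIV - {p}. op_tensor sc (divided_difference p r) (perm_factors \<langle>p \<leftrightarrow> r\<rangle>) id w)
    + Sum_any (\<lambda>i. z_summand sc \<pi> p i w)"

text \<open>An action on W in which the generators act by the prescribed operators.\<close>

definition prescribed_action ::
  "complex \<Rightarrow> (complex \<Rightarrow> 'v \<Rightarrow> 'v) \<Rightarrow> ('m affine_gl \<Rightarrow> 'v \<Rightarrow> 'v) \<Rightarrow>
    ('n::finite cherednik_gen free_algebra set \<Rightarrow>
      ('n, 'm::finite, 'v::ab_group_add) W \<Rightarrow> ('n, 'm, 'v) W) \<Rightarrow> bool"
  where "prescribed_action \<kappa> sc \<pi> \<rho> \<longleftrightarrow>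
    cherednik_action \<kappa> (pm_scale sc) \<rho> \<and>
    (\<forall>p. \<rho> (cherednik_class \<kappa> (gx p)) = op_tensor sc (\<lambda>f. xpow p 1 * f) id id) \<and>
    (\<forall>p. \<rho> (cherednik_class \<kappa> (gxi p)) = op_tensor sc (\<lambda>f. xpow p (- 1) * f) id id) \<and>
    (\<forall>\<sigma>. \<rho> (cherednik_class \<kappa> (gs \<sigma>)) = op_tensor sc (perm_vars \<sigma>) (perm_factors \<sigma>) id) \<and>
    (\<forall>p. \<rho> (cherednik_class \<kappa> (gz p)) = z_operator \<kappa> sc \<pi> p)"

end

theory Submission
  imports Defs
begin

text \<open>
  The relation for \<open>[z\<^sub>p, z\<^sub>q]\<close> and the invariance of \<open>qW\<close> under \<open>z\<^sub>p\<close> are both reduced to the subspace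
  of \<open>W\<close> of degree zero in all variables, which generates \<open>W\<close> over the Laurent polynomials. By
  the twisted Leibniz rule for the divided differences, the commutators of \<open>z\<^sub>p\<close> with the variables are
  the prescribed ones, and a formal computation with them shows that
  \<open>[z\<^sub>p, z\<^sub>q] - \<sigma>\<^sub>p\<^sub>q (z\<^sub>p - z\<^sub>q)\<close> and \<open>[z\<^sub>p, P]\<close>, for \<open>P\<close> in the affine Lie algebra, commute with
  multiplication by Laurent polynomials. On the subspace of degree zero the derivations
  and divided differences vanish and \<open>\<sigma>\<^sub>p\<^sub>q\<close> acts as the sum of all \<open>E\<^sub>a\<^sub>b\<^sup>(\<^sup>p\<^sup>) E\<^sub>b\<^sub>a\<^sup>(\<^sup>q\<^sup>)\<close>, so that only commutators
  of matrix units and of the affine Lie algebra remain. For \<open>P = E\<^sub>c\<^sub>d t\<^sup>-\<^sup>j\<close> the result is the sum of an element of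
  \<open>qW\<close> and a multiple of \<open>j x\<^sub>p\<^sup>-\<^sup>j (E\<^sub>c\<^sub>d\<^sup>(\<^sup>p\<^sup>) (C - \<kappa> + m) - \<delta>\<^sub>c\<^sub>d)\<close>; at the level \<open>\<kappa> - m\<close> only the trace term
  is left, and it cancels in \<open>sl\<^sub>m\<close>.
\<close>

section \<open>Operators on Laurent polynomials\<close>

lemma swap_commute: "\<langle>p \<leftrightarrow> q\<rangle> = \<langle>q \<leftrightarrow> p\<rangle>"
  by (rule perm_eqI) (metis apply_swap_eq_iff swap_sym)

lemma swap_conjugate: "\<sigma> * \<langle>p \<leftrightarrow> q\<rangle> = \<langle>\<sigma> \<langle>$\<rangle> p \<leftrightarrow> \<sigma> \<langle>$\<rangle> q\<rangle> * \<sigma>"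
proof (rule perm_eqI)
  fix a
  show "(\<sigma> * \<langle>p \<leftrightarrow> q\<rangle>) \<langle>$\<rangle> a = (\<langle>\<sigma> \<langle>$\<rangle> p \<leftrightarrow> \<sigma> \<langle>$\<rangle> q\<rangle> * \<sigma>) \<langle>$\<rangle> a"
    by (cases "a = p"; cases "a = q") (auto simp: apply_times apply_inj)
qed

lemma poly_mapping_additive_eqI:
  fixes F G :: "('k \<Rightarrow>\<^sub>0 'a::ab_group_add) \<Rightarrow> 'b::ab_group_add"
  assumes "Modules.additive F" "Modules.additive G"
    and "\<And>k c. F (Poly_Mapping.single k c) = G (Poly_Mapping.single k c)"
  shows "F f = G f"
proof (induction f rule: poly_mapping_add_induct)
  case zero
  have "F 0 = G 0"
    using assms(3)[of undefined 0] by simp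
  then show ?case .
next
  case (add k c h)
  then show ?case
    using assms by (simp add: additive.add)
qed

lemma vector_space_complex: "vector_space ((*) :: complex \<Rightarrow> complex \<Rightarrow> complex)"
  by unfold_locales (simp_all add: algebra_simps)

lemma vector_space_pm_scale:
  assumes "vector_space sc"
  shows "vector_space (pm_scale sc :: complex \<Rightarrow> ('k \<Rightarrow>\<^sub>0 'v::ab_group_add) \<Rightarrow> _)"
proof -
  interpret vector_space sc by fact
  show ?thesis
    by unfold_locales
      (auto intro!: poly_mapping_eqI simp: lookup_pm_scale lookup_add scale_right_distrib scale_left_distrib)
qed

text \<open>Scalars become multiplications by constant Laurent polynomials, so that the product
  rules below also yield linearity over the complex numbers.\<close>

lemma pm_scale_eq_times: "pm_scale (*) c f = Poly_Mapping.single 0 c * (f :: 'n laurent)"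
proof (induction f rule: poly_mapping_add_induct)
  case zero
  show ?case by (simp add: pm_scale_zero[OF vector_space_complex])
next
  case (add k d h)
  then show ?case
    by (simp add: pm_scale_add[OF vector_space_complex] pm_scale_single[OF vector_space_complex] mult_single distrib_left)
qed

lemma laurent_linearI:
  fixes A :: "'n laurent \<Rightarrow> 'n laurent"
  assumes "\<And>f g. A (f + g) = A f + A g" "\<And>c f. A (Poly_Mapping.single 0 c * f) = Poly_Mapping.single 0 c * A f"
  shows "Vector_Spaces.linear (pm_scale (*)) (pm_scale (*)) A"
proof -
  interpret vector_space "pm_scale (*) :: complex \<Rightarrow> 'n laurent \<Rightarrow> _"
    by (rule vector_space_pm_scale[OF vector_space_complex])
  show ?thesis
    by unfold_locales (simp_all add: assms pm_scale_eq_times)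
qed

lemma xpow_zero: "xpow p 0 = 1"
  by (simp add: xpow_def)

lemma xpow_cancel: "xpow p 1 * (xpow p (- 1) * f) = f" "xpow p (- 1) * (xpow p 1 * f) = f"
  by (simp_all add: xpow_mult xpow_zero flip: mult.assoc)

lemma perm_vars_single [simp]:
  "perm_vars \<sigma> (Poly_Mapping.single k c) = Poly_Mapping.single (perm_exponent \<sigma> k) c"
  by (simp add: perm_vars_def)

lemma perm_vars_add: "perm_vars \<sigma> (f + g) = perm_vars \<sigma> f + perm_vars \<sigma> g"
  unfolding perm_vars_def by (rule lin_ext_add) (simp_all add: single_add)

lemma perm_exponent_add: "perm_exponent \<sigma> (k + l) = perm_exponent \<sigma> k + perm_exponent \<sigma> l"
  by (rule poly_mapping_eqI) (simp add: lookup_add)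

lemma perm_exponent_zero [simp]: "perm_exponent \<sigma> 0 = 0"
  by (rule poly_mapping_eqI) simp

lemma apply_inverse_cancel [simp]:
  "inverse \<sigma> \<langle>$\<rangle> (\<sigma> \<langle>$\<rangle> p) = p" "\<sigma> \<langle>$\<rangle> (inverse \<sigma> \<langle>$\<rangle> p) = p"
  by (metis apply_inverse bij_apply bij_inv_eq_iff)+

lemma perm_exponent_single: "perm_exponent \<sigma> (Poly_Mapping.single p i) = Poly_Mapping.single (\<sigma> \<langle>$\<rangle> p) i"
  by (rule poly_mapping_eqI) (auto simp: lookup_single when_def)

lemma perm_exponent_mult: "perm_exponent (\<sigma> * \<tau>) k = perm_exponent \<sigma> (perm_exponent \<tau> k)"
  by (rule poly_mapping_eqI) (simp add: perm_mult_commute apply_times group.inverse_distrib_swap)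

lemma perm_exponent_one [simp]: "perm_exponent 1 k = k"
  by (rule poly_mapping_eqI) simp

lemma perm_vars_zero [simp]: "perm_vars \<sigma> 0 = 0"
  by (simp add: perm_vars_def)

lemma additive_perm_vars: "Modules.additive (perm_vars \<sigma>)"
  by unfold_locales (rule perm_vars_add)

lemma perm_vars_diff: "perm_vars \<sigma> (f - g) = perm_vars \<sigma> f - perm_vars \<sigma> g"
  by (rule additive.diff[OF additive_perm_vars])

lemma perm_vars_mult: "perm_vars \<sigma> (f * g) = perm_vars \<sigma> f * perm_vars \<sigma> g"
proof -
  have "perm_vars \<sigma> (Poly_Mapping.single k c * g) = perm_vars \<sigma> (Poly_Mapping.single k c) * perm_vars \<sigma> g" for k c
    by (induction g rule: poly_mapping_add_induct)
      (simp_all add: distrib_left perm_vars_add mult_single perm_exponent_add)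
  then show ?thesis
    by (induction f rule: poly_mapping_add_induct) (simp_all add: distrib_right perm_vars_add)
qed

lemma perm_vars_xpow [simp]: "perm_vars \<sigma> (xpow p i) = xpow (\<sigma> \<langle>$\<rangle> p) i"
  by (simp add: xpow_def perm_exponent_single)

lemma perm_vars_compose: "perm_vars \<sigma> (perm_vars \<tau> f) = perm_vars (\<sigma> * \<tau>) f"
  by (induction f rule: poly_mapping_add_induct) (simp_all add: perm_vars_add perm_exponent_mult)

section \<open>Euler operators and divided differences\<close>

definition euler :: "'n \<Rightarrow> 'n laurent \<Rightarrow> 'n laurent"
  where "euler p f = xpow p 1 * partial_deriv p f"

lemma euler_single:
  "euler p (Poly_Mapping.single k c) = Poly_Mapping.single k (of_int (Poly_Mapping.lookup k p) * c)"
  by (simp add: euler_def partial_deriv_def xpow_def mult_single)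

lemma euler_add: "euler p (f + g) = euler p f + euler p g"
proof -
  have "partial_deriv p (f + g) = partial_deriv p f + partial_deriv p g"
    unfolding partial_deriv_def by (rule lin_ext_add) (simp_all add: distrib_left single_add)
  then show ?thesis
    by (simp add: euler_def distrib_left)
qed

lemma euler_zero [simp]: "euler p 0 = 0"
  by (simp add: euler_def partial_deriv_def)

lemma euler_mult: "euler p (f * g) = f * euler p g + euler p f * g"
proof -
  have "euler p (Poly_Mapping.single k c * g) =
      Poly_Mapping.single k c * euler p g + euler p (Poly_Mapping.single k c) * g" for k c
  proof (induction g rule: poly_mapping_add_induct)
    case (add l d h)
    have "euler p (Poly_Mapping.single k c * Poly_Mapping.single l d) =
        Poly_Mapping.single k c * euler p (Poly_Mapping.single l d)
        + euler p (Poly_Mapping.single k c) * Poly_Mapping.single l d"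
      by (simp add: euler_single mult_single lookup_add algebra_simps flip: single_add)
    with add show ?case
      by (simp add: distrib_left euler_add)
  qed simp
  then show ?thesis
    by (induction f rule: poly_mapping_add_induct) (simp_all add: distrib_right distrib_left euler_add)
qed

lemma euler_xpow: "euler p (xpow q i) = (if q = p then of_int i * xpow p i else 0)"
  by (simp add: xpow_def euler_single mult_single lookup_single flip: single_of_int)

lemma euler_const [simp]: "euler p (Poly_Mapping.single 0 c) = 0"
  by (simp add: euler_single)

lemma perm_vars_euler: "perm_vars \<sigma> (euler p f) = euler (\<sigma> \<langle>$\<rangle> p) (perm_vars \<sigma> f)"
  by (induction f rule: poly_mapping_add_induct)
    (simp_all add: euler_add perm_vars_add euler_single)

lemma divided_difference_eq:
  assumes "p \<noteq> r"
  shows "(xpow p 1 - xpow r 1) * divided_difference p r f = xpow p 1 * (f - perm_vars \<langle>p \<leftrightarrow> r\<rangle> f)"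
  unfolding divided_difference_def by (rule theI'[OF divided_difference_ex1[OF assms]])

text \<open>No division is ever carried out: each formula below is compared after multiplication by
  \<open>xpow p 1 - xpow r 1\<close>, which is legitimate since the quotient is unique.\<close>

lemma divided_difference_eqI:
  assumes "p \<noteq> r" "(xpow p 1 - xpow r 1) * g = xpow p 1 * (f - perm_vars \<langle>p \<leftrightarrow> r\<rangle> f)"
  shows "divided_difference p r f = g"
  using divided_difference_ex1[OF assms(1)] divided_difference_eq[OF assms(1)] assms(2) by blast

lemma divided_difference_add:
  assumes "p \<noteq> r"
  shows "divided_difference p r (f + g) = divided_difference p r f + divided_difference p r g"
  by (rule divided_difference_eqI[OF assms], subst distrib_left)
    (simp add: assms divided_difference_eq perm_vars_add right_diff_distrib distrib_left)

text \<open>For the transposition \<sigma>, \<open>f g - \<sigma>(f) \<sigma>(g) = f (g -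
  \<sigma>(g)) + (f - \<sigma>(f)) \<sigma>(g)\<close>. Dividing each summand by the same factor
  gives this twisted Leibniz rule.\<close>

lemma divided_difference_mult:
  assumes "p \<noteq> r"
  shows "divided_difference p r (f * g) =
    f * divided_difference p r g + divided_difference p r f * perm_vars \<langle>p \<leftrightarrow> r\<rangle> g"
proof (rule divided_difference_eqI[OF assms])
  have "(xpow p 1 - xpow r 1) *
      (f * divided_difference p r g + divided_difference p r f * perm_vars \<langle>p \<leftrightarrow> r\<rangle> g) =
      f * ((xpow p 1 - xpow r 1) * divided_difference p r g)
      + ((xpow p 1 - xpow r 1) * divided_difference p r f) * perm_vars \<langle>p \<leftrightarrow> r\<rangle> g"
    by (simp add: distrib_left mult_ac)
  also have "\<dots> = xpow p 1 * (f * g - perm_vars \<langle>p \<leftrightarrow> r\<rangle> (f * g))"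
    unfolding divided_difference_eq[OF assms] by (simp add: perm_vars_mult algebra_simps)
  finally show "(xpow p 1 - xpow r 1) *
      (f * divided_difference p r g + divided_difference p r f * perm_vars \<langle>p \<leftrightarrow> r\<rangle> g) =
      xpow p 1 * (f * g - perm_vars \<langle>p \<leftrightarrow> r\<rangle> (f * g))" .
qed

lemma divided_difference_const [simp]:
  assumes "p \<noteq> r"
  shows "divided_difference p r (Poly_Mapping.single 0 c) = 0"
  by (rule divided_difference_eqI) (simp_all add: assms)

text \<open>Apply \<sigma> to the equation that characterizes the divided difference; conjugation by
  \<sigma> moves the transposition to the images of \<open>p\<close> and \<open>r\<close>.\<close>

lemma perm_vars_divided_difference:
  assumes "p \<noteq> r"
  shows "perm_vars \<sigma> (divided_difference p r f) =
    divided_difference (\<sigma> \<langle>$\<rangle> p) (\<sigma> \<langle>$\<rangle> r) (perm_vars \<sigma> f)"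
proof (rule sym, rule divided_difference_eqI)
  show "\<sigma> \<langle>$\<rangle> p \<noteq> \<sigma> \<langle>$\<rangle> r"
    using assms by (simp add: apply_inj)
  have "(xpow (\<sigma> \<langle>$\<rangle> p) 1 - xpow (\<sigma> \<langle>$\<rangle> r) 1) * perm_vars \<sigma> (divided_difference p r f) =
      perm_vars \<sigma> ((xpow p 1 - xpow r 1) * divided_difference p r f)"
    by (simp add: perm_vars_mult perm_vars_diff)
  then show "(xpow (\<sigma> \<langle>$\<rangle> p) 1 - xpow (\<sigma> \<langle>$\<rangle> r) 1) * perm_vars \<sigma> (divided_difference p r f) =
      xpow (\<sigma> \<langle>$\<rangle> p) 1 * (perm_vars \<sigma> f - perm_vars \<langle>\<sigma> \<langle>$\<rangle> p \<leftrightarrow> \<sigma> \<langle>$\<rangle> r\<rangle> (perm_vars \<sigma> f))"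
    by (simp add: divided_difference_eq[OF assms] perm_vars_mult perm_vars_diff perm_vars_compose
        swap_conjugate)
qed

text \<open>The two products are shifted copies of the same terms
  \<open>x_p^(1-i) x_r^(i-j)\<close>, of which only those for \<open>i = 0\<close> and
  \<open>i = j\<close> remain. The geometric sum is the divided difference of a negative power, and
  its factors \<open>xpow p (- int i)\<close> match the powers in the infinite sum of
  \<open>z p\<close>.\<close>

lemma xpow_telescope:
  "(xpow p 1 - xpow r 1) * (\<Sum>i<j. xpow p (- int i) * xpow r (int i - int j)) =
    xpow p 1 * (xpow r (- int j) - xpow p (- int j))"
proof (induction j)
  case (Suc j)
  \<comment> \<open>From \<open>j\<close> to \<open>Suc j\<close> every old term acquires a factor
    \<open>xpow r (- 1)\<close>, and the term with \<open>i = j\<close> is new.\<close>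
  have "(\<Sum>i<Suc j. xpow p (- int i) * xpow r (int i - int (Suc j))) =
      xpow r (- 1) * (\<Sum>i<j. xpow p (- int i) * xpow r (int i - int j)) + xpow p (- int j) * xpow r (-1)"
    unfolding sum.lessThan_Suc sum_distrib_left
    by (intro arg_cong2[of _ _ _ _ "(+)"] sum.cong) (simp_all add: mult.left_commute[of "xpow r (- 1)"] mult.commute xpow_mult diff_diff_eq add.commute)
  then have "(xpow p 1 - xpow r 1) * (\<Sum>i<Suc j. xpow p (- int i) * xpow r (int i - int (Suc j))) =
     xpow r (- 1) * (xpow p 1 * (xpow r (- int j) - xpow p (- int j)))
     + (xpow p 1 - xpow r 1) * (xpow p (- int j) * xpow r (-1))"
    unfolding Suc[symmetric] by (simp only: distrib_left mult.left_commute)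
  also have "\<dots> = xpow p 1 * (xpow r (- int (Suc j)) - xpow p (- int (Suc j)))"
    by (simp add: algebra_simps xpow_mult xpow_cancel)
  finally show ?case .
qed (simp add: xpow_zero)

lemma divided_difference_xpow_neg:
  assumes "p \<noteq> r"
  shows "divided_difference p r (xpow r (- int j)) = (\<Sum>i<j. xpow p (- int i) * xpow r (int i - int j))"
    "divided_difference p r (xpow p (- int j)) = - (\<Sum>i<j. xpow p (- int i) * xpow r (int i - int j))"
  by (rule divided_difference_eqI[OF assms], simp only: mult_minus_right xpow_telescope, simp add: algebra_simps)+

lemma divided_difference_xpow_1:
  assumes "p \<noteq> r"
  shows "divided_difference p r (xpow r 1) = - xpow p 1"
    "divided_difference p r (xpow p 1) = xpow p 1"
    "q \<noteq> p \<Longrightarrow> q \<noteq> r \<Longrightarrow> divided_difference p r (xpow q i) = 0"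
  by (rule divided_difference_eqI[OF assms], simp add: assms algebra_simps)+

section \<open>Operators on W\<close>

lemma linear_lin_ext:
  fixes g :: "'k \<Rightarrow> complex \<Rightarrow> ('l \<Rightarrow>\<^sub>0 complex)"
  assumes "\<And>k c d. g k (c + d) = g k c + g k d" "\<And>k c d. g k (c * d) = pm_scale (*) c (g k d)"
  shows "Vector_Spaces.linear (pm_scale (*)) (pm_scale (*)) (lin_ext g)"
proof -
  interpret K: vector_space "pm_scale (*) :: complex \<Rightarrow> ('k \<Rightarrow>\<^sub>0 complex) \<Rightarrow> _"
    by (rule vector_space_pm_scale[OF vector_space_complex])
  interpret L: vector_space "pm_scale (*) :: complex \<Rightarrow> ('l \<Rightarrow>\<^sub>0 complex) \<Rightarrow> _"
    by (rule vector_space_pm_scale[OF vector_space_complex])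
  have zero: "g k 0 = 0" for k
    using assms(1)[of k 0 0] by simp
  have add: "lin_ext g (f + h) = lin_ext g f + lin_ext g h" for f h
    by (rule lin_ext_add) (simp_all add: zero assms(1))
  have "lin_ext g (pm_scale (*) c f) = pm_scale (*) c (lin_ext g f)" for c f
    by (induction f rule: poly_mapping_add_induct)
      (simp_all add: K.scale_right_distrib L.scale_right_distrib add zero assms(2)
        pm_scale_single[OF vector_space_complex])
  then show ?thesis
    by unfold_locales (simp_all add: add)
qed

lemma linear_perm_factors: "Vector_Spaces.linear (pm_scale (*)) (pm_scale (*)) (perm_factors \<sigma>)"
  unfolding perm_factors_def
  by (rule linear_lin_ext) (simp_all add: single_add pm_scale_single[OF vector_space_complex])

lemma linear_E_at: "Vector_Spaces.linear (pm_scale (*)) (pm_scale (*)) (E_at a b p)"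
  unfolding E_at_def
  by (rule linear_lin_ext)
    (simp_all add: single_add pm_scale_single[OF vector_space_complex] pm_scale_zero[OF vector_space_complex])

lemma linear_id_pm: "Vector_Spaces.linear (pm_scale (*)) (pm_scale (*)) (id :: ('k \<Rightarrow>\<^sub>0 complex) \<Rightarrow> _)"
  by (rule vector_space.linear_id[OF vector_space_pm_scale[OF vector_space_complex]])

lemma linear_mult_laurent: "Vector_Spaces.linear (pm_scale (*)) (pm_scale (*)) (\<lambda>g. f * g :: 'n laurent)"
  by (rule laurent_linearI) (simp_all add: distrib_left mult.left_commute)

lemma linear_perm_vars: "Vector_Spaces.linear (pm_scale (*)) (pm_scale (*)) (perm_vars \<sigma>)"
  by (rule laurent_linearI) (simp_all add: perm_vars_add perm_vars_mult)

lemma linear_euler: "Vector_Spaces.linear (pm_scale (*)) (pm_scale (*)) (euler p)"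
  by (rule laurent_linearI) (simp_all add: euler_add euler_mult)

lemma linear_divided_difference:
  "p \<noteq> r \<Longrightarrow> Vector_Spaces.linear (pm_scale (*)) (pm_scale (*)) (divided_difference p r)"
  by (rule laurent_linearI) (simp_all add: divided_difference_add divided_difference_mult)

lemma perm_fun_upd:
  "(\<lambda>q. if inverse \<sigma> \<langle>$\<rangle> q = p then a else s (inverse \<sigma> \<langle>$\<rangle> q)) =
    (\<lambda>q. s (inverse \<sigma> \<langle>$\<rangle> q))(\<sigma> \<langle>$\<rangle> p := a)"
  by (auto simp: fun_eq_iff)

lemma perm_factors_mult: "perm_factors \<sigma> (perm_factors \<tau> u) = perm_factors (\<sigma> * \<tau>) u"
proof -
  interpret P: Vector_Spaces.linear "pm_scale (*)" "pm_scale (*)" "perm_factors \<sigma> :: ('a, 'b) tpower \<Rightarrow> _" for \<sigma>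
    by (rule linear_perm_factors)
  show ?thesis
    by (induction u rule: poly_mapping_add_induct)
      (auto simp: P.add, auto simp: perm_factors_def apply_times)
qed

section \<open>The elementary operators on W and their commutation rules\<close>

locale smooth_affine_module =
  fixes sc :: "complex \<Rightarrow> 'v \<Rightarrow> 'v::ab_group_add"
    and \<pi> :: "'m::finite affine_gl \<Rightarrow> 'v \<Rightarrow> 'v"
  assumes affine_module: "affine_module sc \<pi>"
    and smooth: "\<forall>v. \<exists>i. \<forall>Y \<in> gl_degree_ge i. \<pi> Y v = 0"
begin

sublocale vector_space sc
  using affine_module by (simp add: affine_module_def)

lemma linear_rep: "Vector_Spaces.linear sc sc (\<pi> Y)"
  using affine_module by (simp add: affine_module_def)

lemma linear_id_sc: "Vector_Spaces.linear sc sc id"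
  by (rule linear_id)

lemma op_tensor_additive:
  assumes "Vector_Spaces.linear sc sc G"
  shows "Modules.additive (op_tensor sc A B G)"
proof -
  interpret G: Vector_Spaces.linear sc sc G by fact
  show ?thesis
    unfolding op_tensor_def
    by unfold_locales
      (rule lin_ext_add, auto simp: G.zero G.add pure_tensor_zero[OF vector_space_axioms]
        pure_tensor_add_right[OF vector_space_axioms])
qed

lemma op_tensor_single:
  assumes "Vector_Spaces.linear sc sc G"
  shows "op_tensor sc A B G (Poly_Mapping.single (k, s) v) =
    pure_tensor sc (A (Poly_Mapping.single k 1)) (B (Poly_Mapping.single s 1)) (G v)"
proof -
  interpret G: Vector_Spaces.linear sc sc G by fact
  show ?thesis
    by (simp add: op_tensor_def G.zero pure_tensor_zero[OF vector_space_axioms])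
qed

text \<open>The inner operator turns a basis tensor into a pure tensor, on which the outer one acts
  factor by factor. Commutation rules on W thus reduce to rules in the single tensor slots.\<close>

lemma op_tensor_compose:
  assumes "Vector_Spaces.linear (pm_scale (*)) (pm_scale (*)) A"
    and "Vector_Spaces.linear (pm_scale (*)) (pm_scale (*)) B"
    and "Vector_Spaces.linear sc sc G" "Vector_Spaces.linear sc sc G'"
  shows "op_tensor sc A B G (op_tensor sc A' B' G' w) =
    op_tensor sc (\<lambda>x. A (A' x)) (\<lambda>x. B (B' x)) (\<lambda>x. G (G' x)) w"
proof -
  have GG': "Vector_Spaces.linear sc sc (\<lambda>x. G (G' x))"
    using Vector_Spaces.linear_compose[OF assms(4,3)] by (simp add: comp_def)
  note add = op_tensor_additive[THEN additive.add]
  show ?thesis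
  proof (rule poly_mapping_additive_eqI[of "\<lambda>w. op_tensor sc A B G (op_tensor sc A' B' G' w)"])
    show "Modules.additive (\<lambda>w. op_tensor sc A B G (op_tensor sc A' B' G' w))"
      by unfold_locales (simp add: add assms)
    show "Modules.additive (op_tensor sc (\<lambda>x. A (A' x)) (\<lambda>x. B (B' x)) (\<lambda>x. G (G' x)))"
      by (rule op_tensor_additive[OF GG'])
    show "op_tensor sc A B G (op_tensor sc A' B' G' (Poly_Mapping.single ks v)) =
      op_tensor sc (\<lambda>x. A (A' x)) (\<lambda>x. B (B' x)) (\<lambda>x. G (G' x)) (Poly_Mapping.single ks v)" for ks v
      by (cases ks) (simp add: op_tensor_single assms GG'
        op_tensor_pure_tensor[OF vector_space_axioms assms(1-3)])
  qed
qed

definition X :: "'n laurent \<Rightarrow> ('n, 'm, 'v) W \<Rightarrow> ('n, 'm, 'v) W"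
  where "X f = op_tensor sc (\<lambda>g. f * g) id id"

definition S :: "'n perm \<Rightarrow> ('n, 'm, 'v) W \<Rightarrow> ('n, 'm, 'v) W"
  where "S \<sigma> = op_tensor sc (perm_vars \<sigma>) (perm_factors \<sigma>) id"

definition E :: "'m \<Rightarrow> 'm \<Rightarrow> 'n \<Rightarrow> ('n, 'm, 'v) W \<Rightarrow> ('n, 'm, 'v) W"
  where "E a b p = op_tensor sc id (E_at a b p) id"

definition F :: "'m affine_basis \<Rightarrow> ('n, 'm, 'v) W \<Rightarrow> ('n, 'm, 'v) W"
  where "F g = op_tensor sc id id (\<pi> (basis_elt g))"

definition D :: "'n \<Rightarrow> ('n, 'm, 'v) W \<Rightarrow> ('n, 'm, 'v) W"
  where "D p = op_tensor sc (euler p) id id"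

definition T :: "'n \<Rightarrow> 'n \<Rightarrow> ('n, 'm, 'v) W \<Rightarrow> ('n, 'm, 'v) W"
  where "T p r = op_tensor sc (divided_difference p r) (perm_factors \<langle>p \<leftrightarrow> r\<rangle>) id"

lemmas op_defs = X_def S_def E_def F_def D_def T_def
text \<open>\<open>op_tensor_compose\<close> produces composed slots as \<lambda>-terms; with
  \<open>id\<close> unfolded, the identity slots take the same form on both sides.\<close>

lemmas op_defs' = op_defs[unfolded id_def]
lemmas slot_linear = linear_perm_factors linear_E_at linear_id_pm linear_mult_laurent linear_perm_vars
  linear_euler linear_divided_difference linear_rep linear_id_sc linear_id_pm[unfolded id_def]
  linear_id_sc[unfolded id_def]

sublocale X: additive "X f" for f :: "'n laurent"
  unfolding X_def by (rule op_tensor_additive[OF linear_id_sc])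
sublocale S: additive "S \<sigma>" for \<sigma> :: "'n perm"
  unfolding S_def by (rule op_tensor_additive[OF linear_id_sc])
sublocale E: additive "E a b p" for a b and p :: 'n
  unfolding E_def by (rule op_tensor_additive[OF linear_id_sc])
sublocale F: additive "F g :: ('n, 'm, 'v) W \<Rightarrow> _" for g
  unfolding F_def by (rule op_tensor_additive[OF linear_rep])
sublocale D: additive "D p" for p :: 'n
  unfolding D_def by (rule op_tensor_additive[OF linear_id_sc])
sublocale T: additive "T p r" for p r :: 'n
  unfolding T_def by (rule op_tensor_additive[OF linear_id_sc])

lemmas additive_simps = X.add S.add E.add F.add D.add T.add X.diff S.diff E.diff F.diff D.diff T.diff
  X.minus S.minus E.minus F.minus D.minus T.minus X.sum S.sum E.sum F.sum D.sum T.sum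

lemmas zero_simps [simp] = X.zero S.zero E.zero F.zero D.zero T.zero

lemma W_induct [case_names add single]:
  fixes w :: "('n, 'm, 'v) W"
  assumes "\<And>x y. P x \<Longrightarrow> P y \<Longrightarrow> P (x + y)" and "\<And>k s v. P (Poly_Mapping.single (k, s) v)"
  shows "P w"
proof (induction w rule: poly_mapping_add_induct)
  case zero
  show ?case
    using assms(2)[of undefined undefined 0] by simp
next
  case (add ks v w)
  then show ?case
    using assms by (cases ks) simp
qed

lemma X_single: "X (Poly_Mapping.single l c) (Poly_Mapping.single (k, s) v) = Poly_Mapping.single (l + k, s) (sc c v)"
  by (simp add: X_def op_tensor_single[OF linear_id_sc] mult_single pure_tensor_single[OF vector_space_axioms])

lemma S_single: "S \<sigma> (Poly_Mapping.single (k, s) v) =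
    Poly_Mapping.single (perm_exponent \<sigma> k, \<lambda>q. s (inverse \<sigma> \<langle>$\<rangle> q)) v"
  by (simp add: S_def op_tensor_single[OF linear_id_sc] perm_factors_def pure_tensor_single[OF vector_space_axioms])

lemma E_single: "E a b p (Poly_Mapping.single (k, s) v) =
    (if s p = b then Poly_Mapping.single (k, s(p := a)) v else 0)"
  by (simp add: E_def op_tensor_single[OF linear_id_sc] E_at_def pure_tensor_single[OF vector_space_axioms]
    pure_tensor_zero[OF vector_space_axioms])

lemma F_single: "F g (Poly_Mapping.single (k, s) v) = Poly_Mapping.single (k, s) (\<pi> (basis_elt g) v)"
  by (simp add: F_def op_tensor_single[OF linear_rep] pure_tensor_single[OF vector_space_axioms])

lemma D_single: "D p (Poly_Mapping.single (k, s) v) =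
    Poly_Mapping.single (k, s) (sc (of_int (Poly_Mapping.lookup k p)) v)"
  by (simp add: D_def op_tensor_single[OF linear_id_sc] euler_single pure_tensor_single[OF vector_space_axioms])

lemma X_mult: "X f (X g w) = X (f * g) w"
  by (simp add: op_defs' op_tensor_compose slot_linear mult.assoc)

lemma X_add_left: "X (f + g) w = X f w + X g w"
  by (induction w rule: W_induct) (simp_all add: X.add ac_simps, simp add: X_def op_tensor_single[OF linear_id_sc] distrib_right
    pure_tensor_add_left[OF vector_space_axioms])

sublocale X_left: additive "\<lambda>f. X f w" for w :: "('n, 'm, 'v) W"
  by unfold_locales (rule X_add_left)

lemma X_one [simp]: "X 1 w = w"
  by (induction w rule: W_induct) (simp_all add: X.add, simp add: X_def op_tensor_single[OF linear_id_sc]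
    pure_tensor_single[OF vector_space_axioms])

lemma X_const: "X (Poly_Mapping.single 0 c) w = pm_scale sc c w"
proof -
  interpret W: vector_space "pm_scale sc :: complex \<Rightarrow> ('a, 'm, 'v) W \<Rightarrow> _"
    by (rule vector_space_pm_scale[OF vector_space_axioms])
  show ?thesis
    by (induction w rule: W_induct) (simp_all add: X.add W.scale_right_distrib X_single, simp add: pm_scale_def)
qed

lemma E_X: "E a b p (X f w) = X f (E a b p w)"
  and F_X: "F g (X f w) = X f (F g w)"
  and S_X: "S \<sigma> (X f w) = X (perm_vars \<sigma> f) (S \<sigma> w)"
  and S_F: "S \<sigma> (F g w) = F g (S \<sigma> w)"
  and E_F: "E a b p (F g w) = F g (E a b p w)"
  and D_E: "D p (E a b q w) = E a b q (D p w)"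
  and D_F: "D p (F g w) = F g (D p w)"
  and T_F: "p \<noteq> r \<Longrightarrow> T p r (F g w) = F g (T p r w)"
  and S_D: "S \<sigma> (D p w) = D (\<sigma> \<langle>$\<rangle> p) (S \<sigma> w)"
  by (simp_all add: op_defs' op_tensor_compose slot_linear perm_vars_mult perm_vars_euler)

lemma S_mult: "S \<sigma> (S \<tau> w) = S (\<sigma> * \<tau>) w"
  by (induction w rule: W_induct) (simp_all add: S.add S_single perm_exponent_mult apply_times)

lemma S_one [simp]: "S 1 w = w"
  by (induction w rule: W_induct) (simp_all add: S.add S_single)

lemma S_E: "S \<sigma> (E a b p w) = E a b (\<sigma> \<langle>$\<rangle> p) (S \<sigma> w)"
  by (induction w rule: W_induct) (auto simp add: additive_simps S_single E_single perm_fun_upd)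

lemma E_E_same: "E a b p (E c d p w) = (if b = c then E a d p w else 0)"
  by (induction w rule: W_induct) (auto simp add: additive_simps E_single)

lemma E_E_diff: "p \<noteq> q \<Longrightarrow> E a b p (E c d q w) = E c d q (E a b p w)"
  by (induction w rule: W_induct) (auto simp add: additive_simps E_single fun_upd_twist)

lemma E_sum_one: "(\<Sum>a\<in>UNIV. E a a p w) = w"
  by (induction w rule: W_induct) (auto simp add: additive_simps E_single sum.distrib)

lemma D_X: "D p (X f w) = X f (D p w) + X (euler p f) w"
  by (induction w rule: W_induct)
    (simp_all add: additive_simps ac_simps, simp add: op_defs' op_tensor_compose slot_linear op_tensor_single euler_mult
      pure_tensor_add_left[OF vector_space_axioms] op_tensor_pure_tensor[OF vector_space_axioms])

text \<open>The permuted second factor in the twisted Leibniz rule and the permutation of tensor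
  factors in \<open>T\<close> combine to the operator \<open>S\<close>. This is the origin of the
  transpositions in the commutators of \<open>z p\<close> with the variables.\<close>

lemma T_X: "p \<noteq> r \<Longrightarrow> T p r (X f w) = X f (T p r w) + X (divided_difference p r f) (S \<langle>p \<leftrightarrow> r\<rangle> w)"
  by (induction w rule: W_induct)
    (simp_all add: additive_simps ac_simps, simp add: op_defs' op_tensor_compose slot_linear op_tensor_single divided_difference_mult
      pure_tensor_add_left[OF vector_space_axioms] op_tensor_pure_tensor[OF vector_space_axioms])

lemma S_T: "p \<noteq> r \<Longrightarrow> S \<sigma> (T p r w) = T (\<sigma> \<langle>$\<rangle> p) (\<sigma> \<langle>$\<rangle> r) (S \<sigma> w)"
  by (simp add: op_defs' op_tensor_compose slot_linear perm_vars_divided_difference perm_factors_mult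
     swap_conjugate apply_inj)

end

section \<open>The affine Lie algebra on W, vectors of degree zero, and the infinite sum in
  \<open>z p\<close>\<close>

context smooth_affine_module
begin

sublocale rep: Vector_Spaces.linear sc sc "\<pi> Y" for Y
  by (rule linear_rep)

lemma rep_linear_left: "Vector_Spaces.linear (pm_scale (*)) sc (\<lambda>Y. \<pi> Y v)"
  using affine_module by (simp add: affine_module_def)

lemma rep_bracket: "\<pi> (affine_bracket Y Z) v = \<pi> Y (\<pi> Z v) - \<pi> Z (\<pi> Y v)"
  using affine_module by (simp add: affine_module_def)

lemma affine_bracket_basis:
  fixes g h :: "'m affine_basis"
  shows "affine_bracket (basis_elt g) (basis_elt h) = basis_bracket g h"
proof -
  interpret W: vector_space "pm_scale (*) :: complex \<Rightarrow> 'm affine_gl \<Rightarrow> _"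
    by (rule vector_space_pm_scale[OF vector_space_complex])
  show ?thesis
    by (simp add: affine_bracket_def)
qed

text \<open>The affine bracket, transported to W. The integer in the central term is written as a
  constant Laurent polynomial, so that the rules for \<open>X\<close> apply to it.\<close>

lemma F_F:
  fixes w :: "('n, 'm, 'v) W"
  shows "F (Et a b i) (F (Et c d j) w) = F (Et c d j) (F (Et a b i) w)
    + (if b = c then F (Et a d (i + j)) w else 0) - (if a = d then F (Et c b (i + j)) w else 0)
    + (if i = - j \<and> a = d \<and> b = c then X (of_int i) (F Cen w) else 0)"
proof (induction w rule: W_induct)
  case (single k s v)
  interpret R: Vector_Spaces.linear "pm_scale (*)" sc "\<lambda>Y. \<pi> Y v"
    by (rule rep_linear_left)
  have cen: "\<pi> (Poly_Mapping.single Cen (of_int l)) v = sc (of_int l) (\<pi> (basis_elt Cen) v)" for l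
    using R.scale[of "of_int l" "basis_elt Cen"] by (simp add: pm_scale_def)
  have "\<pi> (basis_bracket (Et a b i) (Et c d j)) v =
      (if b = c then \<pi> (basis_elt (Et a d (i + j))) v else 0)
      - (if a = d then \<pi> (basis_elt (Et c b (i + j))) v else 0)
      + (if i = - j \<and> a = d \<and> b = c then sc (of_int i) (\<pi> (basis_elt Cen) v) else 0)"
    by (simp only: basis_bracket.simps R.add R.diff if_distrib[of "\<lambda>Y. \<pi> Y v"] R.zero cen)
  with rep_bracket[of "basis_elt (Et a b i)" "basis_elt (Et c d j)" v, unfolded affine_bracket_basis]
  have eq: "\<pi> (basis_elt (Et a b i)) (\<pi> (basis_elt (Et c d j)) v) =
      \<pi> (basis_elt (Et c d j)) (\<pi> (basis_elt (Et a b i)) v) + (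
      (if b = c then \<pi> (basis_elt (Et a d (i + j))) v else 0)
      - (if a = d then \<pi> (basis_elt (Et c b (i + j))) v else 0)
      + (if i = - j \<and> a = d \<and> b = c then sc (of_int i) (\<pi> (basis_elt Cen) v) else 0))"
    by (metis add_diff_cancel_left' add_diff_eq)
  have X_int: "X (of_int i) u = X (Poly_Mapping.single 0 (of_int i)) u" for u :: "('n, 'm, 'v) W"
    by (simp only: single_of_int)
  show ?case
    unfolding F_single eq X_int X_single
    by (simp add: single_add single_diff)
qed (simp_all add: additive_simps)

text \<open>The vectors of degree zero in all variables.\<close>

definition flat :: "('n, 'm, 'v) W \<Rightarrow> bool"
  where "flat w \<longleftrightarrow> (\<forall>p. D p w = 0)"

lemma lookup_D: "Poly_Mapping.lookup (D p w) (k, s) = sc (of_int (Poly_Mapping.lookup k p)) (Poly_Mapping.lookup w (k, s))"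
  by (induction w rule: W_induct)
    (auto simp: additive_simps lookup_add scale_right_distrib D_single lookup_single when_def)

text \<open>\<open>D p\<close> multiplies the coefficient at a monomial by its exponent at
  \<open>p\<close>. Nonzero integers are invertible scalars, so a flat vector has nonzero
  coefficients only at the exponent vector \<open>0\<close>.\<close>

lemma flat_induct [consumes 1, case_names add single]:
  assumes "flat w" and "\<And>x y. P x \<Longrightarrow> P y \<Longrightarrow> P (x + y)" and "\<And>s v. P (Poly_Mapping.single (0, s) v)"
  shows "P w"
proof -
  have zero: "fst ks = 0" if "ks \<in> Poly_Mapping.keys w" for ks
  proof (rule poly_mapping_eqI)
    fix p
    have "sc (of_int (Poly_Mapping.lookup (fst ks) p)) (Poly_Mapping.lookup w ks) = 0"
      using assms(1) lookup_D[of p w "fst ks" "snd ks"] by (simp add: flat_def)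
    then show "Poly_Mapping.lookup (fst ks) p = Poly_Mapping.lookup 0 p"
      using that by (simp add: in_keys_iff)
  qed
  have "P (\<Sum>ks\<in>K. Poly_Mapping.single ks (Poly_Mapping.lookup w ks))"
    if "finite K" "K \<subseteq> Poly_Mapping.keys w" for K
    using that
  proof (induction K)
    case empty
    show ?case
      using assms(3)[of undefined 0] by simp
  next
    case (insert ks K)
    then have "P (Poly_Mapping.single ks (Poly_Mapping.lookup w ks))"
      using assms(3) zero[of ks] by (cases ks) simp
    with insert show ?case
      using assms(2) by simp
  qed
  from this[OF finite_keys order.refl] show ?thesis
    by (simp flip: poly_mapping_expansion)
qed

lemma flat_single: "flat (Poly_Mapping.single (0, s) v)"
  by (simp add: flat_def D_single)

lemma flat_E: "flat w \<Longrightarrow> flat (E a b p w)"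
  by (simp add: flat_def D_E)

lemma flat_F: "flat w \<Longrightarrow> flat (F g w)"
  by (simp add: flat_def D_F)

lemma flat_sum: "(\<And>i. i \<in> I \<Longrightarrow> flat (f i)) \<Longrightarrow> flat (\<Sum>i\<in>I. f i)"
  by (simp add: flat_def additive_simps)

lemma T_flat: "flat w \<Longrightarrow> p \<noteq> r \<Longrightarrow> T p r w = 0"
proof (induction w rule: flat_induct)
  case (single s v)
  have "divided_difference p r 1 = 0"
    using divided_difference_const[OF single, of 1] by simp
  then show ?case
    by (simp add: T_def op_tensor_single[OF linear_id_sc] pure_tensor_zero[OF vector_space_axioms])
qed (simp add: additive_simps)

lemma S_swap_flat:
  assumes "flat w" "p \<noteq> q"
  shows "S \<langle>p \<leftrightarrow> q\<rangle> w = (\<Sum>a\<in>UNIV. \<Sum>b\<in>UNIV. E a b p (E b a q w))"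
  using assms
proof (induction w rule: flat_induct)
  case (single s v)
  \<comment> \<open>A single summand survives, with \<open>b = s p\<close> and
    \<open>a = s q\<close>; it exchanges these two entries of \<open>s\<close>.\<close>
  have "E a b p (E b a q (Poly_Mapping.single (0, s) v)) =
      (if b = s p then if a = s q then Poly_Mapping.single (0, s(p := s q, q := s p)) v else 0 else 0)" for a b
    using single by (auto simp: E_single fun_upd_twist)
  moreover have "(\<lambda>r. s (\<langle>p \<leftrightarrow> q\<rangle> \<langle>$\<rangle> r)) = s(p := s q, q := s p)"
    using single by (auto simp: fun_eq_iff)
  ultimately show ?case
    by (simp add: S_single)
qed (simp add: additive_simps sum.distrib)

text \<open>A basis vector with exponent vector \<open>k\<close> is the monomial of \<open>k\<close>
  times a flat vector.\<close>

lemma spanned_by_flat [case_names add X]: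
  fixes w :: "('n, 'm, 'v) W"
  assumes "\<And>x y. P x \<Longrightarrow> P y \<Longrightarrow> P (x + y)" and "\<And>f u. flat u \<Longrightarrow> P (X f u)"
  shows "P w"
proof (induction w rule: W_induct)
  case (single k s v)
  show ?case
    using assms(2)[OF flat_single, of "Poly_Mapping.single k 1" s v] by (simp add: X_single)
qed (rule assms(1))

text \<open>A truncation bound for the infinite sum in \<open>z p\<close>. It may be raised at will,
  so finitely many vectors always have a common bound.\<close>

definition kills_from :: "nat \<Rightarrow> ('n, 'm, 'v) W \<Rightarrow> bool"
  where "kills_from M w \<longleftrightarrow> (\<forall>n\<ge>M. \<forall>a b. F (Et a b (int n)) w = 0)"

lemma kills_from_mono: "kills_from M w \<Longrightarrow> M \<le> M' \<Longrightarrow> kills_from M' w"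
  by (auto simp: kills_from_def)

lemma kills_from_ops:
  assumes "kills_from M w"
  shows "kills_from M (X f w)" "kills_from M (S \<sigma> w)" "kills_from M (E a b p w)" "kills_from M (D p w)"
    "p \<noteq> r \<Longrightarrow> kills_from M (T p r w)"
  using assms by (simp_all add: kills_from_def F_X flip: S_F E_F D_F T_F)

lemma kills_from_add: "kills_from M w \<Longrightarrow> kills_from M w' \<Longrightarrow> kills_from M (w + w')"
  by (simp add: kills_from_def additive_simps)

lemma ex_kills_from: "\<exists>M. kills_from M w"
proof (induction w rule: W_induct)
  case (add x y)
  then obtain M M' where "kills_from M x" "kills_from M' y" by blast
  then have "kills_from (max M M') (x + y)"
    by (meson kills_from_add kills_from_mono max.cobounded1 max.cobounded2)
  then show ?case ..
next
  case (single k s v)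
  obtain i where i: "\<And>Y. Y \<in> gl_degree_ge i \<Longrightarrow> \<pi> Y v = 0"
    using smooth by blast
  \<comment> \<open>The degree \<open>i\<close> provided by smoothness may be negative, whereas only
    the powers of \<open>t\<close> from \<open>0\<close> on occur in \<open>z p\<close>.\<close>
  have "kills_from (nat i) (Poly_Mapping.single (k, s) v)"
    unfolding kills_from_def F_single
  proof (intro allI impI)
    fix n and a b :: 'm
    assume "nat i \<le> n"
    then have "basis_elt (Et a b (int n)) \<in> gl_degree_ge i"
      by (auto simp: gl_degree_ge_def)
    then show "Poly_Mapping.single (k, s) (\<pi> (basis_elt (Et a b (int n))) v) = 0"
      by (simp add: i)
  qed
  then show ?case ..
qed

text \<open>\<open>A p\<close> is the sum over \<open>i\<close> in the operator \<open>z\<^sub>p\<close>, and \<open>x\<^sub>p\<^sup>-\<^sup>i B p i\<close> is its \<open>i\<close>-th summand.\<close>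

definition B :: "'n \<Rightarrow> nat \<Rightarrow> ('n, 'm, 'v) W \<Rightarrow> ('n, 'm, 'v) W"
  where "B p i w = (\<Sum>a\<in>UNIV. \<Sum>b\<in>UNIV. E a b p (F (Et b a (int i)) w))"

definition A :: "'n \<Rightarrow> ('n, 'm, 'v) W \<Rightarrow> ('n, 'm, 'v) W"
  where "A p w = Sum_any (\<lambda>i. X (xpow p (- int i)) (B p i w))"

lemma B_zero_if_kills_from: "kills_from M w \<Longrightarrow> M \<le> i \<Longrightarrow> B p i w = 0"
  by (simp add: B_def kills_from_def)

lemma finite_A: "finite {i. X (xpow p (- int i)) (B p i w) \<noteq> 0}"
proof -
  obtain M where "kills_from M w" using ex_kills_from by blast
  then have "{i. X (xpow p (- int i)) (B p i w) \<noteq> 0} \<subseteq> {..<M}"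
    using B_zero_if_kills_from by (force simp: not_less[symmetric])
  then show ?thesis
    by (rule finite_subset) simp
qed

text \<open>Any valid bound may serve as the upper limit, so that sums for different vectors can be
  taken over the same range.\<close>

lemma A_eq:
  assumes "kills_from M w"
  shows "A p w = (\<Sum>i<M. X (xpow p (- int i)) (B p i w))"
  unfolding A_def
proof (rule Sum_any.expand_superset)
  show "{i. X (xpow p (- int i)) (B p i w) \<noteq> 0} \<subseteq> {..<M}"
    using B_zero_if_kills_from[OF assms] by (force simp: not_less[symmetric])
qed simp

lemma B_add: "B p i (w + w') = B p i w + B p i w'"
  by (simp add: B_def additive_simps sum.distrib)

lemma B_X: "B p i (X f w) = X f (B p i w)"
  by (simp add: B_def additive_simps E_X F_X)

lemma S_B: "S \<sigma> (B p i w) = B (\<sigma> \<langle>$\<rangle> p) i (S \<sigma> w)"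
  by (simp add: B_def additive_simps S_E S_F)

lemma A_add: "A p (w + w') = A p w + A p w'"
proof -
  obtain M M' where "kills_from M w" "kills_from M' w'"
    using ex_kills_from by blast
  then have M: "kills_from (max M M') w" "kills_from (max M M') w'"
    by (auto elim: kills_from_mono)
  show ?thesis
    by (simp add: A_eq[OF M(1)] A_eq[OF M(2)] A_eq[OF kills_from_add[OF M]] B_add additive_simps sum.distrib)
qed

lemma A_X: "A p (X f w) = X f (A p w)"
proof -
  obtain M where M: "kills_from M w"
    using ex_kills_from by blast
  show ?thesis
    by (simp add: A_eq[OF M] A_eq[OF kills_from_ops(1)[OF M]] B_X additive_simps X_mult mult.commute)
qed

lemma S_A: "S \<sigma> (A p w) = A (\<sigma> \<langle>$\<rangle> p) (S \<sigma> w)"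
proof -
  obtain M where M: "kills_from M w"
    using ex_kills_from by blast
  show ?thesis
    by (simp add: A_eq[OF M] A_eq[OF kills_from_ops(2)[OF M]] S_B additive_simps S_X)
qed

lemma z_summand_eq: "z_summand sc \<pi> p i w = X (xpow p (- int i)) (B p i w)"
  unfolding z_summand_def B_def X.sum
  by (simp add: op_defs' op_tensor_compose slot_linear)

end

section \<open>The operators \<open>z p\<close> and their commutators with permutations and
  variables\<close>

locale cherednik_operators = smooth_affine_module sc \<pi>
  for sc :: "complex \<Rightarrow> 'v \<Rightarrow> 'v::ab_group_add" and \<pi> :: "'m::finite affine_gl \<Rightarrow> 'v \<Rightarrow> 'v" +
  fixes \<kappa> :: complex
begin

definition z :: "'n::finite \<Rightarrow> ('n, 'm, 'v) W \<Rightarrow> ('n, 'm, 'v) W"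
  where "z p w = X (Poly_Mapping.single 0 \<kappa>) (D p w) + (\<Sum>r\<in>UNIV - {p}. T p r w) + A p w"

lemma z_operator_eq: "z_operator \<kappa> sc \<pi> p = (z p :: ('n::finite, 'm, 'v) W \<Rightarrow> _)"
proof (rule ext)
  fix w :: "('n, 'm, 'v) W"
  have "euler p = (\<lambda>f. xpow p 1 * partial_deriv p f)"
    by (simp add: fun_eq_iff euler_def)
  then show "z_operator \<kappa> sc \<pi> p w = z p w"
    by (simp add: z_operator_def z_def A_def z_summand_eq X_const T_def D_def)
qed

sublocale z: additive "z p" for p :: "'n::finite"
  by unfold_locales (simp add: z_def additive_simps A_add sum.distrib)

text \<open>\<open>A p\<close> commutes with multiplication, so the two extra terms come from the
  Leibniz rules \<open>D_X\<close> and \<open>T_X\<close> alone.\<close>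

lemma z_X: "z p (X f w) = X f (z p w) + X (Poly_Mapping.single 0 \<kappa> * euler p f) w
    + (\<Sum>r\<in>UNIV - {p}. X (divided_difference p r f) (S \<langle>p \<leftrightarrow> r\<rangle> w))"
  by (simp add: z_def additive_simps D_X T_X A_X sum.distrib X_mult mult.commute)

lemma S_z: "S \<sigma> (z p w) = z (\<sigma> \<langle>$\<rangle> p) (S \<sigma> w)"
proof -
  have bij: "bij_betw (\<lambda>r. \<sigma> \<langle>$\<rangle> r) (UNIV - {p}) (UNIV - {\<sigma> \<langle>$\<rangle> p})"
    by (rule bij_betw_byWitness[of _ "\<lambda>r. inverse \<sigma> \<langle>$\<rangle> r"]) (auto simp: apply_inj)
  have "(\<Sum>r\<in>UNIV - {p}. S \<sigma> (T p r w)) = (\<Sum>r\<in>UNIV - {p}. T (\<sigma> \<langle>$\<rangle> p) (\<sigma> \<langle>$\<rangle> r) (S \<sigma> w))"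
    by (rule sum.cong) (auto simp: S_T)
  also have "\<dots> = (\<Sum>r\<in>UNIV - {\<sigma> \<langle>$\<rangle> p}. T (\<sigma> \<langle>$\<rangle> p) r (S \<sigma> w))"
    by (rule sum.reindex_bij_betw[OF bij])
  finally show ?thesis
    by (simp add: z_def additive_simps S_X S_D S_A)
qed

lemma z_flat: "flat w \<Longrightarrow> z p w = A p w"
  by (simp add: z_def T_flat) (simp add: flat_def)

text \<open>The divided difference of \<open>x_p\<close> is \<open>x_p\<close> for every
  \<open>r\<close>; that of \<open>x_q\<close> is \<open>- x_p\<close> for \<open>r = q\<close> and
  zero for all other \<open>r\<close>.\<close>

lemma z_xpow:
  shows "z p (X (xpow p 1) w) = X (xpow p 1) (z p w) + X (Poly_Mapping.single 0 \<kappa> * xpow p 1) w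
      + (\<Sum>r\<in>UNIV - {p}. X (xpow p 1) (S \<langle>p \<leftrightarrow> r\<rangle> w))"
    and "p \<noteq> q \<Longrightarrow> z p (X (xpow q 1) w) = X (xpow q 1) (z p w) - X (xpow p 1) (S \<langle>p \<leftrightarrow> q\<rangle> w)"
proof -
  show "z p (X (xpow p 1) w) = X (xpow p 1) (z p w) + X (Poly_Mapping.single 0 \<kappa> * xpow p 1) w
      + (\<Sum>r\<in>UNIV - {p}. X (xpow p 1) (S \<langle>p \<leftrightarrow> r\<rangle> w))"
    by (simp add: z_X euler_xpow divided_difference_xpow_1)
  assume "p \<noteq> q"
  have "(\<Sum>r\<in>UNIV - {p}. X (divided_difference p r (xpow q 1)) (S \<langle>p \<leftrightarrow> r\<rangle> w)) =
      (\<Sum>r\<in>UNIV - {p}. if r = q then - X (xpow p 1) (S \<langle>p \<leftrightarrow> q\<rangle> w) else 0)"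
    by (rule sum.cong) (use \<open>p \<noteq> q\<close> in \<open>auto simp: divided_difference_xpow_1 X_left.minus X_left.zero\<close>)
  then show "z p (X (xpow q 1) w) = X (xpow q 1) (z p w) - X (xpow p 1) (S \<langle>p \<leftrightarrow> q\<rangle> w)"
    using \<open>p \<noteq> q\<close> by (simp add: z_X euler_xpow X_left.zero)
qed

end

text \<open>Products of two truncated infinite sums are regrouped by total degree; the part of the
  square beyond the triangle vanishes.\<close>

lemma sum_square_triangle:
  fixes g :: "nat \<Rightarrow> nat \<Rightarrow> 'a::comm_monoid_add"
  assumes "\<And>i j. M \<le> i + j \<Longrightarrow> g i j = 0"
  shows "(\<Sum>i<M. \<Sum>j<M. g i j) = (\<Sum>n<M. \<Sum>i\<le>n. g i (n - i))"
proof -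
  have "(\<Sum>i<M. \<Sum>j<M. g i j) = (\<Sum>(i, j)\<in>{..<M} \<times> {..<M}. g i j)"
    by (simp add: sum.cartesian_product)
  also have "\<dots> = (\<Sum>(i, j)\<in>{(i, j). i + j < M}. g i j)"
    by (rule sum.mono_neutral_right) (use assms in \<open>auto intro: leI\<close>)
  also have "\<dots> = (\<Sum>n<M. \<Sum>i\<le>n. g i (n - i))"
    by (rule sum.triangle_reindex)
  finally show ?thesis .
qed

lemma sum_UNIV_pair: "(\<Sum>(a, b)\<in>UNIV. g a b) = (\<Sum>a\<in>UNIV. \<Sum>b\<in>UNIV. g a b)"
  by (simp add: sum.cartesian_product flip: UNIV_Times_UNIV)

section \<open>Commutators of the summands \<open>B p i\<close>\<close>

context smooth_affine_module
begin

lemma op_if [simp]: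
  "E a b p (if P then w else 0) = (if P then E a b p w else 0)"
  "X f (if P then w else 0) = (if P then X f w else 0)"
  by simp_all

text \<open>Constants, variables and their inverses generate the Laurent polynomials, and an
  operator that commutes with an invertible operator commutes with its inverse.\<close>

lemma commute_X:
  fixes G :: "('n::finite, 'm, 'v) W \<Rightarrow> ('n, 'm, 'v) W"
  assumes "Modules.additive G"
    and const: "\<And>c w. G (X (Poly_Mapping.single 0 c) w) = X (Poly_Mapping.single 0 c) (G w)"
    and x: "\<And>r w. G (X (xpow r 1) w) = X (xpow r 1) (G w)"
  shows "G (X f w) = X f (G w)"
proof -
  interpret G: additive G by fact
  have mult: "G (X (f * g) w) = X (f * g) (G w)"
    if "\<And>w. G (X f w) = X f (G w)" "\<And>w. G (X g w) = X g (G w)" for f g w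
    using that by (simp flip: X_mult)
  have inv: "G (X (xpow r (- 1)) w) = X (xpow r (- 1)) (G w)" for r w
  proof -
    have "G (X (xpow r (- 1)) w) = X (xpow r (- 1)) (X (xpow r 1) (G (X (xpow r (- 1)) w)))"
      by (simp add: X_mult xpow_mult xpow_zero)
    also have "\<dots> = X (xpow r (- 1)) (G (X (xpow r 1) (X (xpow r (- 1)) w)))"
      by (simp only: x)
    finally show ?thesis
      by (simp add: X_mult xpow_mult xpow_zero)
  qed
  have pow: "G (X (xpow r i) w) = X (xpow r i) (G w)" for r i w
  proof (induction i arbitrary: w rule: int_induct[where k = 0])
    case base
    show ?case by (simp add: xpow_zero)
  next
    case (step1 i)
    then show ?case
      using mult[of "xpow r i" "xpow r 1" w] x by (simp add: xpow_mult)
  next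
    case (step2 i)
    then show ?case
      using mult[of "xpow r i" "xpow r (- 1)" w] inv by (simp add: xpow_mult)
  qed
  have mono: "G (X (Poly_Mapping.single k 1) w) = X (Poly_Mapping.single k 1) (G w)" for k w
  proof (induction k arbitrary: w rule: poly_mapping_add_induct)
    case (add r i k)
    then show ?case
      using mult[of "xpow r i" "Poly_Mapping.single k 1" w] pow by (simp add: xpow_def mult_single)
  qed simp
  show ?thesis
  proof (induction f arbitrary: w rule: poly_mapping_add_induct)
    case (add k c f)
    have "Poly_Mapping.single k c = Poly_Mapping.single 0 c * Poly_Mapping.single k 1"
      by (simp add: mult_single)
    then have "G (X (Poly_Mapping.single k c) w) = X (Poly_Mapping.single k c) (G w)"
      using mult const mono by metis
    with add show ?case
      by (simp add: X_add_left G.add)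
  qed (simp add: X_left.zero G.zero)
qed

lemma kills_from_F:
  assumes "kills_from M w"
  shows "kills_from M (F (Et c d (int j)) w)"
  unfolding kills_from_def
proof (intro allI impI)
  fix n a b
  assume "M \<le> n"
  then have *: "F (Et a' b' (int n)) w = 0" "F (Et a' b' (int n + int j)) w = 0" for a' b'
    using assms[unfolded kills_from_def, rule_format, of n] assms[unfolded kills_from_def, rule_format, of "n + j"]
    by simp_all
  \<comment> \<open>The bracket has degree \<open>n + j\<close>, hence at least \<open>M\<close>.
    Its central term could occur only for \<open>n = j = 0\<close>, and there its coefficient
    \<open>n\<close> is zero.\<close>
  have "int n = - int j \<longleftrightarrow> n = 0 \<and> j = 0"
    by auto
  then show "F (Et a b (int n)) (F (Et c d (int j)) w) = 0"
    using assms[unfolded kills_from_def, rule_format, of 0] \<open>M \<le> n\<close> by (subst F_F) (auto simp: * X_left.zero)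
qed

lemma kills_from_zero [simp]: "kills_from M 0"
  by (simp add: kills_from_def)

lemma kills_from_sum: "(\<And>i. i \<in> I \<Longrightarrow> kills_from M (f i)) \<Longrightarrow> kills_from M (\<Sum>i\<in>I. f i)"
  by (induction I rule: infinite_finite_induct) (simp_all add: kills_from_add)

lemma kills_from_B: "kills_from M w \<Longrightarrow> kills_from M (B p i w)"
  unfolding B_def by (intro kills_from_sum kills_from_ops kills_from_F)

lemma flat_B: "flat w \<Longrightarrow> flat (B p i w)"
  unfolding B_def by (intro flat_sum flat_E flat_F)

text \<open>Writing the transposition as a sum of matrix units and contracting in the factor
  \<open>q\<close> gives a triple sum; this and the next lemma produce the two halves of the
  commutator in \<open>B_commutator\<close>.\<close>

lemma S_swap_B_right:
  assumes "flat w" "p \<noteq> q"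
  shows "S \<langle>p \<leftrightarrow> q\<rangle> (B q n w) = (\<Sum>a\<in>UNIV. \<Sum>b\<in>UNIV. \<Sum>d\<in>UNIV. E a b p (E b d q (F (Et d a (int n)) w)))"
proof -
  have "S \<langle>p \<leftrightarrow> q\<rangle> (B q n w) = (\<Sum>a\<in>UNIV. \<Sum>b\<in>UNIV. \<Sum>c\<in>UNIV. \<Sum>d\<in>UNIV.
      if a = c then E a b p (E b d q (F (Et d c (int n)) w)) else 0)"
    apply (subst S_swap_flat[OF flat_B[OF assms(1)] assms(2)])
    unfolding B_def E.sum E_E_same op_if by (rule refl)
  also have "\<dots> = (\<Sum>a\<in>UNIV. \<Sum>b\<in>UNIV. \<Sum>d\<in>UNIV. \<Sum>c\<in>UNIV.
      if a = c then E a b p (E b d q (F (Et d c (int n)) w)) else 0)"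
    by (rule sum.cong[OF refl], rule sum.cong[OF refl], rule sum.swap)
  also have "\<dots> = (\<Sum>a\<in>UNIV. \<Sum>b\<in>UNIV. \<Sum>d\<in>UNIV. E a b p (E b d q (F (Et d a (int n)) w)))"
    by (simp only: sum.delta[OF finite] sum.delta'[OF finite] UNIV_I if_True)
  finally show ?thesis .
qed

lemma S_swap_B_left:
  assumes "flat w" "p \<noteq> q"
  shows "S \<langle>p \<leftrightarrow> q\<rangle> (B p n w) = (\<Sum>a\<in>UNIV. \<Sum>b\<in>UNIV. \<Sum>c\<in>UNIV. E a b p (E c a q (F (Et b c (int n)) w)))"
proof -
  have "S \<langle>p \<leftrightarrow> q\<rangle> (B p n w) = (\<Sum>a\<in>UNIV. \<Sum>b\<in>UNIV. \<Sum>c\<in>UNIV. \<Sum>d\<in>UNIV.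
      if b = c then E a d p (E b a q (F (Et d c (int n)) w)) else 0)"
    apply (subst S_swap_flat[OF flat_B[OF assms(1)] assms(2)])
    unfolding B_def E.sum E_E_diff[OF assms(2), symmetric]
    unfolding E_E_same op_if by (rule refl)
  also have "\<dots> = (\<Sum>a\<in>UNIV. \<Sum>b\<in>UNIV. \<Sum>d\<in>UNIV. \<Sum>c\<in>UNIV.
      if b = c then E a d p (E b a q (F (Et d c (int n)) w)) else 0)"
    by (rule sum.cong[OF refl], rule sum.cong[OF refl], rule sum.swap)
  also have "\<dots> = (\<Sum>a\<in>UNIV. \<Sum>b\<in>UNIV. \<Sum>d\<in>UNIV. E a d p (E b a q (F (Et d b (int n)) w)))"
    by simp
  also have "\<dots> = (\<Sum>a\<in>UNIV. \<Sum>d\<in>UNIV. \<Sum>b\<in>UNIV. E a d p (E b a q (F (Et d b (int n)) w)))"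
    by (rule sum.cong[OF refl], rule sum.swap)
  finally show ?thesis .
qed

text \<open>Matrix units in different factors commute, so only the brackets of
  \<open>Et b a i\<close> with \<open>Et d c j\<close> contribute. As \<open>i\<close> and
  \<open>j\<close> are nonnegative the central term vanishes, and the two remaining terms are the
  triple sums for \<open>S\<close> applied to \<open>B p\<close> and to \<open>B q\<close>.\<close>

lemma B_commutator:
  assumes "flat w" "p \<noteq> q"
  shows "B p i (B q j w) = B q j (B p i w) + S \<langle>p \<leftrightarrow> q\<rangle> (B p (i + j) w) - S \<langle>p \<leftrightarrow> q\<rangle> (B q (i + j) w)"
proof -
  let ?n = "int i + int j"
  have "int i = - int j \<longleftrightarrow> i = 0 \<and> j = 0"
    by auto
  then have F_F': "F (Et b a (int i)) (F (Et d c (int j)) w) = F (Et d c (int j)) (F (Et b a (int i)) w)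
      + (if a = d then F (Et b c ?n) w else 0) - (if b = c then F (Et d a ?n) w else 0)" for a b c d
    by (subst F_F) (simp add: X_left.zero)
  have "B p i (B q j w) = (\<Sum>a\<in>UNIV. \<Sum>b\<in>UNIV. \<Sum>c\<in>UNIV. \<Sum>d\<in>UNIV.
      E a b p (E c d q (F (Et b a (int i)) (F (Et d c (int j)) w))))"
    unfolding B_def E.sum F.sum E_F ..
  also have "\<dots> = (\<Sum>a\<in>UNIV. \<Sum>b\<in>UNIV. \<Sum>c\<in>UNIV. \<Sum>d\<in>UNIV.
      E a b p (E c d q (F (Et d c (int j)) (F (Et b a (int i)) w))))
      + (\<Sum>a\<in>UNIV. \<Sum>b\<in>UNIV. \<Sum>c\<in>UNIV. \<Sum>d\<in>UNIV. if a = d then E a b p (E c d q (F (Et b c ?n) w)) else 0)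
      - (\<Sum>a\<in>UNIV. \<Sum>b\<in>UNIV. \<Sum>c\<in>UNIV. \<Sum>d\<in>UNIV. if b = c then E a b p (E c d q (F (Et d a ?n) w)) else 0)"
    unfolding F_F' by (simp only: E.add E.diff op_if sum.distrib sum_subtractf)
  also have "(\<Sum>a\<in>UNIV. \<Sum>b\<in>UNIV. \<Sum>c\<in>UNIV. \<Sum>d\<in>UNIV. if a = d then E a b p (E c d q (F (Et b c ?n) w)) else 0)
      = S \<langle>p \<leftrightarrow> q\<rangle> (B p (i + j) w)"
    by (simp add: S_swap_B_left[OF assms])
  also have "(\<Sum>a\<in>UNIV. \<Sum>b\<in>UNIV. \<Sum>c\<in>UNIV. \<Sum>d\<in>UNIV. if b = c then E a b p (E c d q (F (Et d a ?n) w)) else 0)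
      = (\<Sum>a\<in>UNIV. \<Sum>b\<in>UNIV. \<Sum>d\<in>UNIV. \<Sum>c\<in>UNIV. if b = c then E a b p (E c d q (F (Et d a ?n) w)) else 0)"
    by (rule sum.cong[OF refl], rule sum.cong[OF refl], rule sum.swap)
  also have "\<dots> = S \<langle>p \<leftrightarrow> q\<rangle> (B q (i + j) w)"
    by (simp add: S_swap_B_right[OF assms])
  also have "(\<Sum>a\<in>UNIV. \<Sum>b\<in>UNIV. \<Sum>c\<in>UNIV. \<Sum>d\<in>UNIV.
      E a b p (E c d q (F (Et d c (int j)) (F (Et b a (int i)) w)))) = B q j (B p i w)"
  proof -
    have "B q j (B p i w) = (\<Sum>c\<in>UNIV. \<Sum>d\<in>UNIV. \<Sum>a\<in>UNIV. \<Sum>b\<in>UNIV.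
        E a b p (E c d q (F (Et d c (int j)) (F (Et b a (int i)) w))))"
      unfolding B_def E.sum F.sum E_F E_E_diff[OF assms(2)] ..
    also have "\<dots> = (\<Sum>(c, d)\<in>UNIV. \<Sum>(a, b)\<in>UNIV.
        E a b p (E c d q (F (Et d c (int j)) (F (Et b a (int i)) w))))"
      by (simp add: sum_UNIV_pair)
    also have "\<dots> = (\<Sum>(a, b)\<in>UNIV. \<Sum>(c, d)\<in>UNIV.
        E a b p (E c d q (F (Et d c (int j)) (F (Et b a (int i)) w))))"
      unfolding case_prod_unfold by (rule sum.swap)
    also have "\<dots> = (\<Sum>a\<in>UNIV. \<Sum>b\<in>UNIV. \<Sum>c\<in>UNIV. \<Sum>d\<in>UNIV.
        E a b p (E c d q (F (Et d c (int j)) (F (Et b a (int i)) w))))"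
      by (simp add: sum_UNIV_pair)
    finally show ?thesis ..
  qed
  finally show ?thesis .
qed

end

section \<open>The commutator of \<open>z p\<close> and \<open>z q\<close>\<close>

context cherednik_operators
begin

lemma z_const: "z p (X (Poly_Mapping.single 0 c) w) = X (Poly_Mapping.single 0 c) (z p w)"
  by (simp add: z_X X_left.zero)

lemma z_S: "z p (S \<sigma> w) = S \<sigma> (z (inverse \<sigma> \<langle>$\<rangle> p) w)"
  by (simp add: S_z)

text \<open>Among the divided differences in \<open>z p\<close> only the one with
  \<open>r = q\<close> sees the variable \<open>x_q\<close>, and \<open>T\<close> vanishes on flat
  vectors.\<close>

lemma z_X_flat:
  assumes "flat w" "p \<noteq> q"
  shows "z p (X (xpow q (- int j)) w) = X (xpow q (- int j)) (A p w)
    + (\<Sum>i<j. X (xpow p (- int i) * xpow q (int i - int j)) (S \<langle>p \<leftrightarrow> q\<rangle> w))"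
proof -
  have "(\<Sum>r\<in>UNIV - {p}. X (divided_difference p r (xpow q (- int j))) (S \<langle>p \<leftrightarrow> r\<rangle> w)) =
      (\<Sum>r\<in>UNIV - {p}. if r = q then X (divided_difference p q (xpow q (- int j))) (S \<langle>p \<leftrightarrow> q\<rangle> w) else 0)"
    by (rule sum.cong) (use assms in \<open>auto simp: divided_difference_xpow_1 X_left.zero\<close>)
  then show ?thesis
    using assms by (simp add: z_X z_flat euler_xpow X_left.zero divided_difference_xpow_neg X_left.sum)
qed

definition zz_defect :: "'n \<Rightarrow> 'n \<Rightarrow> ('n::finite, 'm, 'v) W \<Rightarrow> ('n, 'm, 'v) W"
  where "zz_defect p q w = z p (z q w) - z q (z p w) - S \<langle>p \<leftrightarrow> q\<rangle> (z p w - z q w)"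

lemma zz_defect_add: "zz_defect p q (w + w') = zz_defect p q w + zz_defect p q w'"
  by (simp add: zz_defect_def z.add S.add z.diff S.diff)

text \<open>By this antisymmetry the case of the variable \<open>x_q\<close> follows from that of
  \<open>x_p\<close>.\<close>

lemma zz_defect_swap: "zz_defect q p w = - zz_defect p q w"
  by (simp add: zz_defect_def S.diff swap_commute[of q p])

lemma zz_defect_X_left:
  fixes w :: "('n::finite, 'm, 'v) W"
  assumes "p \<noteq> q"
  shows "zz_defect p q (X (xpow p 1) w) = X (xpow p 1) (zz_defect p q w)"
proof -
  have rem: "(\<Sum>r\<in>UNIV - {p}. h r) = h q + (\<Sum>r\<in>UNIV - {p, q}. h r)" for h :: "'n \<Rightarrow> ('n, 'm, 'v) W"
  proof -
    have "UNIV - {p} - {q} = UNIV - {p, q}"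
      by auto
    then show ?thesis
      using assms sum.remove[of "UNIV - {p}" q h] by simp
  qed
  \<comment> \<open>The term \<open>r = q\<close> is set apart: moving \<open>z q\<close> past the
    transposition of \<open>p\<close> and \<open>q\<close> turns it into \<open>z p\<close>, while
    it commutes with the other transpositions in the sum.\<close>
  have "(\<Sum>r\<in>UNIV - {p}. X (xpow p 1) (z q (S \<langle>p \<leftrightarrow> r\<rangle> w))) =
      X (xpow p 1) (S \<langle>p \<leftrightarrow> q\<rangle> (z p w)) + (\<Sum>r\<in>UNIV - {p, q}. X (xpow p 1) (z q (S \<langle>p \<leftrightarrow> r\<rangle> w)))"
    using assms by (simp add: rem z_S)
  also have "(\<Sum>r\<in>UNIV - {p, q}. X (xpow p 1) (z q (S \<langle>p \<leftrightarrow> r\<rangle> w))) =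
      (\<Sum>r\<in>UNIV - {p, q}. X (xpow p 1) (S \<langle>p \<leftrightarrow> r\<rangle> (z q w)))"
    using assms by (intro sum.cong) (auto simp: z_S)
  also have "\<dots> = (\<Sum>r\<in>UNIV - {p}. X (xpow p 1) (S \<langle>p \<leftrightarrow> r\<rangle> (z q w))) - X (xpow p 1) (S \<langle>p \<leftrightarrow> q\<rangle> (z q w))"
    by (simp add: rem)
  finally have key: "(\<Sum>r\<in>UNIV - {p}. X (xpow p 1) (z q (S \<langle>p \<leftrightarrow> r\<rangle> w))) =
    X (xpow p 1) (S \<langle>p \<leftrightarrow> q\<rangle> (z p w)) + (\<Sum>r\<in>UNIV - {p}. X (xpow p 1) (S \<langle>p \<leftrightarrow> r\<rangle> (z q w)))
      - X (xpow p 1) (S \<langle>p \<leftrightarrow> q\<rangle> (z q w))"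
    by simp
  note c = X_mult[symmetric, of "Poly_Mapping.single 0 \<kappa>"]
  \<comment> \<open>The last term comes from applying the transposition of \<open>p\<close> and
    \<open>q\<close> twice; the same term in \<open>S\<close> below cancels it.\<close>
  have zpq: "z p (z q (X (xpow p 1) w)) =
      X (xpow p 1) (z p (z q w)) + X (Poly_Mapping.single 0 \<kappa>) (X (xpow p 1) (z q w))
      + (\<Sum>r\<in>UNIV - {p}. X (xpow p 1) (S \<langle>p \<leftrightarrow> r\<rangle> (z q w)))
      - X (xpow q 1) (S \<langle>p \<leftrightarrow> q\<rangle> (z q w)) + X (xpow p 1) w"
    using assms by (simp add: z_xpow z.diff z.add z.sum c z_S swap_commute[of q p] S_mult)
  have zqp: "z q (z p (X (xpow p 1) w)) =
      X (xpow p 1) (z q (z p w)) - X (xpow q 1) (S \<langle>p \<leftrightarrow> q\<rangle> (z p w))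
      + X (Poly_Mapping.single 0 \<kappa>) (X (xpow p 1) (z q w)) - X (Poly_Mapping.single 0 \<kappa>) (X (xpow q 1) (S \<langle>p \<leftrightarrow> q\<rangle> w))
      + (\<Sum>r\<in>UNIV - {p}. X (xpow p 1) (z q (S \<langle>p \<leftrightarrow> r\<rangle> w)))
      - (\<Sum>r\<in>UNIV - {p}. X (xpow q 1) (S \<langle>p \<leftrightarrow> q\<rangle> (S \<langle>p \<leftrightarrow> r\<rangle> w)))"
    using assms by (simp add: z_xpow z.diff z.add z.sum c z_const swap_commute[of q p] X.diff sum_subtractf)
  have S: "S \<langle>p \<leftrightarrow> q\<rangle> (z p (X (xpow p 1) w) - z q (X (xpow p 1) w)) =
      X (xpow q 1) (S \<langle>p \<leftrightarrow> q\<rangle> (z p w)) + X (Poly_Mapping.single 0 \<kappa>) (X (xpow q 1) (S \<langle>p \<leftrightarrow> q\<rangle> w))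
      + (\<Sum>r\<in>UNIV - {p}. X (xpow q 1) (S \<langle>p \<leftrightarrow> q\<rangle> (S \<langle>p \<leftrightarrow> r\<rangle> w)))
      - X (xpow q 1) (S \<langle>p \<leftrightarrow> q\<rangle> (z q w)) + X (xpow p 1) w"
    using assms by (simp add: z_xpow c S.diff S.add S.sum S_X swap_commute[of q p] S_mult)
  show ?thesis
    unfolding zz_defect_def zpq zqp S key by (simp add: X.diff S.diff)
qed

text \<open>\<open>z p\<close> commutes with the transposition of \<open>q, r\<close> and
  \<open>z q\<close> with that of \<open>p, r\<close>. What remains are terms with
  \<open>x_p\<close> or \<open>x_q\<close> and a product of two transpositions; they occur equally
  in the commutator and in the \<open>S\<close> part.\<close>

lemma zz_defect_X_other:
  assumes "p \<noteq> q" "r \<noteq> p" "r \<noteq> q"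
  shows "zz_defect p q (X (xpow r 1) w) = X (xpow r 1) (zz_defect p q w)"
  using assms
  by (simp add: zz_defect_def z_xpow z.diff S.diff X.diff S_X z_S S_mult swap_commute[of q p])

lemma zz_defect_X:
  assumes "p \<noteq> q"
  shows "zz_defect p q (X f w) = X f (zz_defect p q w)"
proof (rule commute_X)
  show "Modules.additive (zz_defect p q)"
    by unfold_locales (rule zz_defect_add)
  show "zz_defect p q (X (Poly_Mapping.single 0 c) w) = X (Poly_Mapping.single 0 c) (zz_defect p q w)" for c w
    by (simp add: zz_defect_def z_const X.diff S_X S.diff)
  show "zz_defect p q (X (xpow r 1) w) = X (xpow r 1) (zz_defect p q w)" for r w
  proof (cases "r = q")
    case True
    then show ?thesis
      using zz_defect_X_left[of q p w] assms by (simp add: zz_defect_swap[of q p] X.minus)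
  next
    case False
    then show ?thesis
      using zz_defect_X_left[of p q w] zz_defect_X_other[of p q r w] assms by (cases "r = p") auto
  qed
qed

text \<open>\<open>B_commutator\<close> contributes all products \<open>x_p^(-i) x_q^(-j)\<close> of
  total degree \<open>-n\<close> with the coefficient \<open>P n - Q n\<close>. The divided
  differences remove all of them except one for each of \<open>P n\<close> and \<open>Q n\<close>,
  and these exceptions form the right hand side of the relation.\<close>

lemma zz_defect_flat:
  assumes "p \<noteq> q" "flat w"
  shows "zz_defect p q w = 0"
proof -
  obtain M where M: "kills_from M w"
    using ex_kills_from by blast
  define f where "f i j = xpow p (- int i) * xpow q (- int j)" for i j
  define P where "P n = S \<langle>p \<leftrightarrow> q\<rangle> (B p n w)" for n
  define Q where "Q n = S \<langle>p \<leftrightarrow> q\<rangle> (B q n w)" for n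
  have PQ: "P n = 0" "Q n = 0" if "M \<le> n" for n
    using B_zero_if_kills_from[OF M that] by (simp_all add: P_def Q_def)
  have zq: "z q w = (\<Sum>j<M. X (xpow q (- int j)) (B q j w))" for q
    using assms by (simp add: z_flat A_eq[OF M])
  have swap: "\<langle>q \<leftrightarrow> p\<rangle> = \<langle>p \<leftrightarrow> q\<rangle>"
    by (rule swap_commute)
  have zz: "z p (z q w) = (\<Sum>j<M. \<Sum>i<M. X (xpow p (- int i) * xpow q (- int j)) (B p i (B q j w)))
      + (\<Sum>n<M. \<Sum>i<n. X (xpow p (- int i) * xpow q (- int (n - i))) (S \<langle>p \<leftrightarrow> q\<rangle> (B q n w)))" if "p \<noteq> q" for p q
  proof -
    have "z p (X (xpow q (- int j)) (B q j w)) =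
        (\<Sum>i<M. X (xpow p (- int i) * xpow q (- int j)) (B p i (B q j w)))
        + (\<Sum>i<j. X (xpow p (- int i) * xpow q (- int (j - i))) (S \<langle>p \<leftrightarrow> q\<rangle> (B q j w)))" for j
    proof -
      have "(\<Sum>i<j. X (xpow p (- int i) * xpow q (int i - int j)) (S \<langle>p \<leftrightarrow> q\<rangle> (B q j w))) =
          (\<Sum>i<j. X (xpow p (- int i) * xpow q (- int (j - i))) (S \<langle>p \<leftrightarrow> q\<rangle> (B q j w)))"
        by (rule sum.cong) (simp_all add: of_nat_diff)
      then show ?thesis
        using z_X_flat[OF flat_B[OF assms(2)] that] A_eq[OF kills_from_B[OF M]]
        by (simp add: X.sum X_mult mult.commute)
    qed
    then show ?thesis
      unfolding zq[of q] by (simp add: z.sum sum.distrib)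
  qed
  have "z p (z q w) = (\<Sum>i<M. \<Sum>j<M. X (f i j) (B p i (B q j w))) + (\<Sum>n<M. \<Sum>i<n. X (f i (n - i)) (Q n))"
    unfolding zz[OF assms(1)] f_def Q_def by (subst sum.swap) (rule refl)
  moreover have "z q (z p w) = (\<Sum>i<M. \<Sum>j<M. X (f i j) (B q j (B p i w))) + (\<Sum>n<M. \<Sum>j<n. X (f (n - j) j) (P n))"
    unfolding zz[OF assms(1)[symmetric]] f_def P_def swap by (simp only: mult.commute)
  moreover have "(\<Sum>i<M. \<Sum>j<M. X (f i j) (B p i (B q j w))) =
      (\<Sum>i<M. \<Sum>j<M. X (f i j) (B q j (B p i w))) + (\<Sum>i<M. \<Sum>j<M. X (f i j) (P (i + j)))
      - (\<Sum>i<M. \<Sum>j<M. X (f i j) (Q (i + j)))"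
    unfolding B_commutator[OF assms(2,1)] P_def Q_def by (simp add: X.add X.diff sum.distrib sum_subtractf)
  \<comment> \<open>The triangle has \<open>i \<le> n\<close> but the divided differences only
    \<open>i < n\<close>; the terms with \<open>i = n\<close> are left over.\<close>
  moreover have "(\<Sum>i<M. \<Sum>j<M. X (f i j) (Q (i + j))) = (\<Sum>n<M. \<Sum>i<n. X (f i (n - i)) (Q n)) + (\<Sum>n<M. X (f n 0) (Q n))"
    by (subst sum_square_triangle) (simp_all add: PQ sum.distrib flip: lessThan_Suc_atMost)
  moreover have "(\<Sum>i<M. \<Sum>j<M. X (f i j) (P (i + j))) = (\<Sum>n<M. \<Sum>j<n. X (f (n - j) j) (P n)) + (\<Sum>n<M. X (f 0 n) (P n))"
  proof -
    \<comment> \<open>For \<open>P\<close> the inner index must be the exponent of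
      \<open>x_q\<close>, since these terms come from the divided differences in
      \<open>z q\<close>.\<close>
    have "(\<Sum>i<M. \<Sum>j<M. X (f i j) (P (i + j))) = (\<Sum>j<M. \<Sum>i<M. X (f i j) (P (i + j)))"
      by (rule sum.swap)
    also have "\<dots> = (\<Sum>n<M. \<Sum>j<n. X (f (n - j) j) (P n)) + (\<Sum>n<M. X (f 0 n) (P n))"
      by (subst sum_square_triangle) (simp_all add: PQ sum.distrib add.commute flip: lessThan_Suc_atMost)
    finally show ?thesis .
  qed
  moreover have "S \<langle>p \<leftrightarrow> q\<rangle> (z p w - z q w) = (\<Sum>n<M. X (f 0 n) (P n)) - (\<Sum>n<M. X (f n 0) (Q n))"
    unfolding zq by (simp add: S.diff S.sum S_X f_def P_def Q_def xpow_zero)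
  ultimately show ?thesis
    by (simp add: zz_defect_def)
qed

lemma z_commutator:
  assumes "p \<noteq> q"
  shows "z p (z q w) - z q (z p w) = S \<langle>p \<leftrightarrow> q\<rangle> (z p w - z q w)"
proof -
  have "zz_defect p q w = 0"
    by (induction w rule: spanned_by_flat) (simp_all add: zz_defect_add zz_defect_X zz_defect_flat assms)
  then show ?thesis
    by (simp add: zz_defect_def)
qed

end

section \<open>The action of the affine Lie algebra on W\<close>

lemma sum_lessThan_add:
  fixes f :: "nat \<Rightarrow> 'a::comm_monoid_add"
  shows "(\<Sum>i<j + n. f i) = (\<Sum>i<j. f i) + (\<Sum>i<n. f (j + i))"
  by (induction n) (simp_all add: add.assoc)

context smooth_affine_module
begin

definition Y :: "'m \<Rightarrow> 'm \<Rightarrow> int \<Rightarrow> ('n::finite, 'm, 'v) W \<Rightarrow> ('n, 'm, 'v) W"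
  where "Y c d n w = (\<Sum>q\<in>UNIV. X (xpow q n) (E c d q w)) + F (Et c d n) w"

lemma W_basis_act_Et: "W_basis_act sc \<pi> (Et c d n) w = Y c d n w"
  by (simp add: Y_def op_defs' op_tensor_compose slot_linear id_def)

lemma W_basis_act_Cen: "W_basis_act sc \<pi> Cen w = F Cen w"
  by (simp add: F_def)

sublocale Y: additive "Y c d n :: ('n::finite, 'm, 'v) W \<Rightarrow> _" for c d n
  by unfold_locales (simp add: Y_def additive_simps sum.distrib)

lemma Y_X: "Y c d n (X f w) = X f (Y c d n w)"
  by (simp add: Y_def additive_simps E_X F_X X_mult mult.commute)

lemma S_Y: "S \<sigma> (Y c d n w) = Y c d n (S \<sigma> w)"
proof -
  have bij: "bij_betw (\<lambda>r. \<sigma> \<langle>$\<rangle> r) UNIV UNIV"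
    by (simp add: bij_apply)
  have "(\<Sum>q\<in>UNIV. S \<sigma> (X (xpow q n) (E c d q w))) =
      (\<Sum>q\<in>UNIV. X (xpow (\<sigma> \<langle>$\<rangle> q) n) (E c d (\<sigma> \<langle>$\<rangle> q) (S \<sigma> w)))"
    by (simp add: S_X S_E)
  also have "\<dots> = (\<Sum>q\<in>UNIV. X (xpow q n) (E c d q (S \<sigma> w)))"
    by (rule sum.reindex_bij_betw[OF bij])
  finally show ?thesis
    by (simp add: Y_def additive_simps S_F)
qed

text \<open>\<open>G p c d n\<close> is the commutator of \<open>B p i\<close> and \<open>E\<^sub>c\<^sub>d t\<^sup>n\<^sup>-\<^sup>i\<close> on \<open>V\<close>, up to the central term.\<close>

definition G :: "'n \<Rightarrow> 'm \<Rightarrow> 'm \<Rightarrow> int \<Rightarrow> ('n, 'm, 'v) W \<Rightarrow> ('n, 'm, 'v) W"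
  where "G p c d n w = (\<Sum>b\<in>UNIV. E c b p (F (Et b d n) w)) - (\<Sum>a\<in>UNIV. E a d p (F (Et c a n) w))"

text \<open>The sum of all tensors of \<open>E_ab\<close> and \<open>E_ba\<close> is invariant under
  the diagonal action. Hence the commutators with a matrix unit in the \<open>p\<close>-th factor
  and on V are opposite: \<open>G\<close> enters here with a minus sign and in \<open>B_F\<close>
  with a plus sign.\<close>

lemma B_E_same: "B p i (E c d p w) = E c d p (B p i w) - G p c d (int i) w"
proof -
  have 1: "B p i (E c d p w) = (\<Sum>a\<in>UNIV. E a d p (F (Et c a (int i)) w))"
  proof -
    have "B p i (E c d p w) = (\<Sum>a\<in>UNIV. \<Sum>b\<in>UNIV. if b = c then E a d p (F (Et b a (int i)) w) else 0)"
      unfolding B_def E_F[symmetric] by (simp add: E_E_same)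
    then show ?thesis
      by simp
  qed
  have 2: "E c d p (B p i w) = (\<Sum>b\<in>UNIV. E c b p (F (Et b d (int i)) w))"
  proof -
    have "E c d p (B p i w) = (\<Sum>a\<in>UNIV. if d = a then \<Sum>b\<in>UNIV. E c b p (F (Et b a (int i)) w) else 0)"
      unfolding B_def E.sum E_E_same by (rule sum.cong) auto
    then show ?thesis
      by simp
  qed
  show ?thesis
    by (simp add: 1 2 G_def)
qed

lemma B_E_diff: "p \<noteq> q \<Longrightarrow> B p i (E c d q w) = E c d q (B p i w)"
  unfolding B_def E.sum E_F[symmetric] by (simp add: E_E_diff)

text \<open>As \<open>n\<close> may be negative, the central term survives for
  \<open>i = - n\<close>; this is how the level enters the proof.\<close>

lemma B_F: "B p i (F (Et c d n) w) = F (Et c d n) (B p i w) + G p c d (int i + n) w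
    + (if int i = - n then X (of_nat i) (E c d p (F Cen w)) else 0)"
proof -
  let ?n = "int i + n"
  have "B p i (F (Et c d n) w) = (\<Sum>a\<in>UNIV. \<Sum>b\<in>UNIV. E a b p (F (Et c d n) (F (Et b a (int i)) w)))
      + (\<Sum>a\<in>UNIV. \<Sum>b\<in>UNIV. if a = c then E a b p (F (Et b d ?n) w) else 0)
      - (\<Sum>a\<in>UNIV. \<Sum>b\<in>UNIV. if b = d then E a b p (F (Et c a ?n) w) else 0)
      + (\<Sum>a\<in>UNIV. \<Sum>b\<in>UNIV. if a = c then if b = d then
          (if int i = - n then X (of_nat i) (E a b p (F Cen w)) else 0) else 0 else 0)"
    unfolding B_def sum.distrib[symmetric] sum_subtractf[symmetric]
    by (intro sum.cong refl, subst F_F) (auto simp: additive_simps E_X equation_minus_iff[of "int i" n])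
  also have "(\<Sum>a\<in>UNIV. \<Sum>b\<in>UNIV. E a b p (F (Et c d n) (F (Et b a (int i)) w))) = F (Et c d n) (B p i w)"
    by (simp add: B_def F.sum E_F)
  also have "(\<Sum>a\<in>UNIV. \<Sum>b\<in>UNIV. if a = c then E a b p (F (Et b d ?n) w) else 0) = (\<Sum>b\<in>UNIV. E c b p (F (Et b d ?n) w))"
    by (subst sum.swap) simp
  also have "(\<Sum>a\<in>UNIV. \<Sum>b\<in>UNIV. if b = d then E a b p (F (Et c a ?n) w) else 0) = (\<Sum>a\<in>UNIV. E a d p (F (Et c a ?n) w))"
    by simp
  also have "(\<Sum>a\<in>UNIV. \<Sum>b\<in>UNIV. if a = c then if b = d then
          (if int i = - n then X (of_nat i) (E a b p (F Cen w)) else 0) else 0 else 0) =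
      (if int i = - n then X (of_nat i) (E c d p (F Cen w)) else 0)"
    by (subst sum.swap) simp
  finally show ?thesis
    by (simp add: G_def)
qed

lemma S_swap_E:
  assumes "flat w" "p \<noteq> r"
  shows "S \<langle>p \<leftrightarrow> r\<rangle> (E c d r w) = (\<Sum>b\<in>UNIV. E c b p (E b d r w))"
    and "S \<langle>p \<leftrightarrow> r\<rangle> (E c d p w) = (\<Sum>a\<in>UNIV. E a d p (E c a r w))"
proof -
  have "S \<langle>p \<leftrightarrow> r\<rangle> (E c d r w) = (\<Sum>a\<in>UNIV. \<Sum>b\<in>UNIV. if a = c then E a b p (E b d r w) else 0)"
    unfolding S_swap_flat[OF flat_E[OF assms(1)] assms(2)] E_E_same op_if by (rule refl)
  also have "\<dots> = (\<Sum>b\<in>UNIV. \<Sum>a\<in>UNIV. if a = c then E a b p (E b d r w) else 0)"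
    by (rule sum.swap)
  finally show "S \<langle>p \<leftrightarrow> r\<rangle> (E c d r w) = (\<Sum>b\<in>UNIV. E c b p (E b d r w))"
    by simp
  have "S \<langle>p \<leftrightarrow> r\<rangle> (E c d p w) = (\<Sum>a\<in>UNIV. \<Sum>b\<in>UNIV. if b = c then E a d p (E b a r w) else 0)"
    unfolding S_swap_flat[OF flat_E[OF assms(1)] assms(2)] E_E_diff[OF assms(2), symmetric]
    unfolding E_E_same op_if by (rule refl)
  then show "S \<langle>p \<leftrightarrow> r\<rangle> (E c d p w) = (\<Sum>a\<in>UNIV. E a d p (E c a r w))"
    by simp
qed

lemma sum_const: "(\<Sum>a\<in>(UNIV :: 'm set). w) = X (of_nat CARD('m)) w"
proof -
  have "(\<Sum>a\<in>(UNIV :: 'm set). w) = (\<Sum>a\<in>(UNIV :: 'm set). X 1 w)"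
    by simp
  also have "\<dots> = X (\<Sum>a\<in>(UNIV :: 'm set). 1) w"
    by (rule X_left.sum[symmetric])
  finally show ?thesis
    by simp
qed

text \<open>The analogue of \<open>G\<close> with the action on W in place of that on V, applied
  last, so that for negative \<open>n\<close> the values lie in \<open>qW\<close>.\<close>

definition H :: "'n \<Rightarrow> 'm \<Rightarrow> 'm \<Rightarrow> int \<Rightarrow> ('n::finite, 'm, 'v) W \<Rightarrow> ('n, 'm, 'v) W"
  where "H p c d n w = (\<Sum>b\<in>UNIV. Y b d n (E c b p w)) - (\<Sum>a\<in>UNIV. Y c a n (E a d p w))"

text \<open>
  The sum over \<open>r \<noteq> p\<close>, which stems from the divided differences, completes the action on \<open>V\<close> in \<open>G\<close> to the
  action on \<open>W\<close> in \<open>H\<close>, except for the \<open>p\<close>-th tensor factor.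
\<close>

lemma G_eq_H:
  "G p c d n w + (\<Sum>r\<in>UNIV - {p}. X (xpow r n) ((\<Sum>b\<in>UNIV. E c b p (E b d r w)) - (\<Sum>a\<in>UNIV. E a d p (E c a r w)))) =
    H p c d n w + X (xpow p n) (X (of_nat CARD('m)) (E c d p w) - (if c = d then w else 0))"
proof -
  have Y: "Y a b n w = X (xpow p n) (E a b p w) + (\<Sum>r\<in>UNIV - {p}. X (xpow r n) (E a b r w)) + F (Et a b n) w" for a b w
    by (simp add: Y_def sum.remove[of UNIV p])
  have 1: "(\<Sum>b\<in>UNIV. Y b d n (E c b p w)) = X (xpow p n) (if c = d then w else 0)
      + (\<Sum>r\<in>UNIV - {p}. X (xpow r n) (\<Sum>b\<in>UNIV. E c b p (E b d r w))) + (\<Sum>b\<in>UNIV. E c b p (F (Et b d n) w))"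
  proof -
    \<comment> \<open>The part of \<open>Y\<close> in the factor \<open>p\<close> meets a matrix
      unit in the same factor; each product is a diagonal unit if \<open>c = d\<close>, and these
      sum to the identity.\<close>
    have a: "(\<Sum>b\<in>UNIV. X (xpow p n) (E b d p (E c b p w))) = X (xpow p n) (if c = d then w else 0)"
      unfolding X.sum[symmetric] E_E_same by (simp add: E_sum_one)
    have "(\<Sum>b\<in>UNIV. \<Sum>r\<in>UNIV - {p}. X (xpow r n) (E b d r (E c b p w))) =
        (\<Sum>r\<in>UNIV - {p}. \<Sum>b\<in>UNIV. X (xpow r n) (E b d r (E c b p w)))"
      by (rule sum.swap)
    also have "\<dots> = (\<Sum>r\<in>UNIV - {p}. X (xpow r n) (\<Sum>b\<in>UNIV. E c b p (E b d r w)))"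
      by (auto intro!: sum.cong simp: X.sum E_E_diff)
    finally show ?thesis
      unfolding Y sum.distrib a by (simp add: E_F)
  qed
  have 2: "(\<Sum>a\<in>UNIV. Y c a n (E a d p w)) = X (xpow p n) (X (of_nat CARD('m)) (E c d p w))
      + (\<Sum>r\<in>UNIV - {p}. X (xpow r n) (\<Sum>a\<in>UNIV. E a d p (E c a r w))) + (\<Sum>a\<in>UNIV. E a d p (F (Et c a n) w))"
  proof -
    \<comment> \<open>Here every product equals \<open>E c d p w\<close>; the number of summands is
      the \<open>m\<close> in the level \<open>\<kappa> - m\<close>.\<close>
    have a: "(\<Sum>a\<in>UNIV. X (xpow p n) (E c a p (E a d p w))) = X (xpow p n) (X (of_nat CARD('m)) (E c d p w))"
      unfolding X.sum[symmetric] E_E_same by (simp add: sum_const)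
    have "(\<Sum>a\<in>UNIV. \<Sum>r\<in>UNIV - {p}. X (xpow r n) (E c a r (E a d p w))) =
        (\<Sum>r\<in>UNIV - {p}. \<Sum>a\<in>UNIV. X (xpow r n) (E c a r (E a d p w)))"
      by (rule sum.swap)
    also have "\<dots> = (\<Sum>r\<in>UNIV - {p}. X (xpow r n) (\<Sum>a\<in>UNIV. E a d p (E c a r w)))"
      by (auto intro!: sum.cong simp: X.sum E_E_diff)
    finally show ?thesis
      unfolding Y sum.distrib a by (simp add: E_F)
  qed
  show ?thesis
    unfolding H_def 1 2 G_def by (simp add: X.diff sum_subtractf)
qed

end

section \<open>The commutator of \<open>z p\<close> with the affine Lie algebra\<close>

context cherednik_operators
begin

definition zY_defect :: "'n \<Rightarrow> 'm \<Rightarrow> 'm \<Rightarrow> nat \<Rightarrow> ('n::finite, 'm, 'v) W \<Rightarrow> ('n, 'm, 'v) W"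
  where "zY_defect p c d j w = z p (Y c d (- int j) w) - Y c d (- int j) (z p w)"

text \<open>The commutators of \<open>z p\<close> with the variables consist of multiplications and
  permutations, and \<open>Y\<close> commutes with both.\<close>

lemma zY_defect_X: "zY_defect p c d j (X f w) = X f (zY_defect p c d j w)"
proof (rule commute_X)
  show "Modules.additive (zY_defect p c d j)"
    by unfold_locales (simp add: zY_defect_def Y.add z.add)
  show "zY_defect p c d j (X (Poly_Mapping.single 0 a) w) = X (Poly_Mapping.single 0 a) (zY_defect p c d j w)" for a w
    by (simp add: zY_defect_def z_const X.diff Y_X)
  show "zY_defect p c d j (X (xpow r 1) w) = X (xpow r 1) (zY_defect p c d j w)" for r w
    by (cases "r = p") (simp_all add: zY_defect_def z_xpow Y_X S_Y Y.add Y.diff Y.sum X.diff)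
qed

lemma z_X_flat_same:
  assumes "flat w"
  shows "z p (X (xpow p (- int j)) w) = X (xpow p (- int j)) (A p w)
    - X (of_nat j * (Poly_Mapping.single 0 \<kappa> * xpow p (- int j))) w
    - (\<Sum>r\<in>UNIV - {p}. \<Sum>i<j. X (xpow p (- int i) * xpow r (int i - int j)) (S \<langle>p \<leftrightarrow> r\<rangle> w))"
proof -
  have "(\<Sum>r\<in>UNIV - {p}. X (divided_difference p r (xpow p (- int j))) (S \<langle>p \<leftrightarrow> r\<rangle> w)) =
      - (\<Sum>r\<in>UNIV - {p}. \<Sum>i<j. X (xpow p (- int i) * xpow r (int i - int j)) (S \<langle>p \<leftrightarrow> r\<rangle> w))"
    unfolding sum_negf[symmetric]
    by (rule sum.cong) (auto simp: divided_difference_xpow_neg X_left.sum X_left.minus sum_negf)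
  then show ?thesis
    using assms by (simp add: z_X z_flat euler_xpow X_left.minus mult.left_commute)
qed

text \<open>The sums of \<open>G\<close> over nonnegative degrees cancel between the factor
  \<open>p\<close> and V. In the negative degrees the divided differences complete \<open>G\<close>
  to \<open>H\<close>, and the corrections in the factor \<open>p\<close>, the central term and the
  derivation make up the rest.\<close>

lemma zY_defect_flat:
  assumes "flat w"
  shows "zY_defect p c d j w = (\<Sum>i<j. X (xpow p (- int i)) (H p c d (int i - int j) w))
    + X (of_nat j * xpow p (- int j)) (X (of_nat CARD('m)) (E c d p w) - (if c = d then w else 0)
      + E c d p (F Cen w) - X (Poly_Mapping.single 0 \<kappa>) (E c d p w))"
proof -
  define u where "u = F (Et c d (- int j)) w"
  obtain N1 N2 where N12: "kills_from N1 w" "kills_from N2 u"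
    using ex_kills_from by blast
  \<comment> \<open>The successor ensures that the index \<open>i = j\<close>, which carries the
    central term, lies in the range up to \<open>j + N\<close>.\<close>
  define N where "N = Suc (max N1 N2)"
  have N: "kills_from N w" "kills_from N u"
    using N12 by (auto simp: N_def elim: kills_from_mono)
  then have N': "kills_from (j + N) w" "kills_from (j + N) u"
    by (auto elim: kills_from_mono)
  have flat: "flat (E c d q w)" "flat u" for q
    using assms by (simp_all add: flat_E flat_F u_def)
  let ?R = "\<Sum>r\<in>UNIV - {p}. \<Sum>i<j. X (xpow p (- int i) * xpow r (int i - int j))
    (S \<langle>p \<leftrightarrow> r\<rangle> (E c d r w) - S \<langle>p \<leftrightarrow> r\<rangle> (E c d p w))"
  have A_E_diff: "A p (E c d q w) = E c d q (A p w)" if "q \<noteq> p" for q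
    using that by (simp add: A_eq[OF N(1)] A_eq[OF kills_from_ops(3)[OF N(1)]] B_E_diff additive_simps E_X)
  have A_E: "A p (E c d p w) = E c d p (A p w) - (\<Sum>i<N. X (xpow p (- int i)) (G p c d (int i) w))"
    by (simp add: A_eq[OF N(1)] A_eq[OF kills_from_ops(3)[OF N(1)]] B_E_same additive_simps E_X sum_subtractf)
  have A_F: "A p u = F (Et c d (- int j)) (A p w) + (\<Sum>i<j. X (xpow p (- int i)) (G p c d (int i - int j) w))
      + (\<Sum>i<N. X (xpow p (- int j) * xpow p (- int i)) (G p c d (int i) w))
      + X (of_nat j * xpow p (- int j)) (E c d p (F Cen w))"
  proof -
    have "(\<Sum>i<j + N. if i = j then X (of_nat j * xpow p (- int j)) (E c d p (F Cen w)) else 0) =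
        X (of_nat j * xpow p (- int j)) (E c d p (F Cen w))"
      by (simp add: N_def)
    \<comment> \<open>Cut at \<open>j\<close>, this range yields the negative degrees of
      \<open>G\<close> and, shifted by \<open>j\<close>, exactly the degrees below \<open>N\<close>
      that appear in \<open>A_E\<close>.\<close>
    moreover have "A p u = F (Et c d (- int j)) (A p w) + (\<Sum>i<j + N. X (xpow p (- int i)) (G p c d (int i - int j) w))
      + (\<Sum>i<j + N. if i = j then X (of_nat j * xpow p (- int j)) (E c d p (F Cen w)) else 0)"
      unfolding A_eq[OF N'(1)] A_eq[OF N'(2)] F.sum sum.distrib[symmetric]
      by (rule sum.cong) (auto simp: u_def B_F additive_simps F_X X_mult mult.commute)
    ultimately show ?thesis
      by (simp add: sum_lessThan_add xpow_mult)
  qed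
  have zY: "z p (Y c d (- int j) w) = z p (X (xpow p (- int j)) (E c d p w))
      + (\<Sum>q\<in>UNIV - {p}. z p (X (xpow q (- int j)) (E c d q w))) + z p u"
    by (simp add: Y_def z.add z.sum u_def sum.remove[of UNIV p])
  have Yz: "Y c d (- int j) (z p w) = X (xpow p (- int j)) (E c d p (A p w))
      + (\<Sum>q\<in>UNIV - {p}. X (xpow q (- int j)) (E c d q (A p w))) + F (Et c d (- int j)) (A p w)"
    by (simp add: Y_def z_flat[OF assms] sum.remove[of UNIV p])
  have off: "(\<Sum>q\<in>UNIV - {p}. z p (X (xpow q (- int j)) (E c d q w))) =
      (\<Sum>q\<in>UNIV - {p}. X (xpow q (- int j)) (E c d q (A p w)))
      + (\<Sum>q\<in>UNIV - {p}. \<Sum>i<j. X (xpow p (- int i) * xpow q (int i - int j)) (S \<langle>p \<leftrightarrow> q\<rangle> (E c d q w)))"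
    unfolding sum.distrib[symmetric]
    by (rule sum.cong) (auto simp: z_X_flat flat A_E_diff)
  have "zY_defect p c d j w = (\<Sum>i<j. X (xpow p (- int i)) (G p c d (int i - int j) w)) + ?R
      + X (of_nat j * xpow p (- int j)) (E c d p (F Cen w))
      - X (of_nat j * (Poly_Mapping.single 0 \<kappa> * xpow p (- int j))) (E c d p w)"
    unfolding zY_defect_def zY Yz off z_X_flat_same[OF flat(1)] z_flat[OF flat(2)] A_E A_F
    by (simp add: X.diff X.sum X_mult sum_subtractf)
  also have "?R = (\<Sum>i<j. X (xpow p (- int i)) (\<Sum>r\<in>UNIV - {p}. X (xpow r (int i - int j))
      ((\<Sum>b\<in>UNIV. E c b p (E b d r w)) - (\<Sum>a\<in>UNIV. E a d p (E c a r w)))))"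
  proof -
    have "?R = (\<Sum>i<j. \<Sum>r\<in>UNIV - {p}. X (xpow p (- int i) * xpow r (int i - int j))
      (S \<langle>p \<leftrightarrow> r\<rangle> (E c d r w) - S \<langle>p \<leftrightarrow> r\<rangle> (E c d p w)))"
      by (rule sum.swap)
    also have "\<dots> = (\<Sum>i<j. X (xpow p (- int i)) (\<Sum>r\<in>UNIV - {p}. X (xpow r (int i - int j))
      ((\<Sum>b\<in>UNIV. E c b p (E b d r w)) - (\<Sum>a\<in>UNIV. E a d p (E c a r w)))))"
      unfolding X.sum[symmetric] X_mult[symmetric]
      by (intro sum.cong refl arg_cong[where f = "X _"]) (simp add: S_swap_E[OF assms])
    finally show ?thesis .
  qed
  also have "(\<Sum>i<j. X (xpow p (- int i)) (G p c d (int i - int j) w)) + \<dots> =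
      (\<Sum>i<j. X (xpow p (- int i)) (H p c d (int i - int j) w
        + X (xpow p (int i - int j)) (X (of_nat CARD('m)) (E c d p w) - (if c = d then w else 0))))"
    unfolding sum.distrib[symmetric] X.add[symmetric] G_eq_H ..
  also have "\<dots> = (\<Sum>i<j. X (xpow p (- int i)) (H p c d (int i - int j) w))
      + X (of_nat j * xpow p (- int j)) (X (of_nat CARD('m)) (E c d p w) - (if c = d then w else 0))"
  proof -
    \<comment> \<open>The powers \<open>x_p^(-i)\<close> and \<open>x_p^(i-j)\<close> multiply to
      the same \<open>x_p^(-j)\<close> for each \<open>i\<close>, hence the factor
      \<open>j\<close>.\<close>
    have "(\<Sum>i<j. X (xpow p (- int j)) v) = X (of_nat j * xpow p (- int j)) v" for v
      by (simp flip: X_left.sum)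
    then show ?thesis
      by (simp add: X.add sum.distrib X_mult[of _ "xpow p _"] xpow_mult)
  qed
  finally show ?thesis
    by (simp add: X.add X.diff X_mult mult_ac)
qed

end

section \<open>Representations of the Cherednik algebra by generators and relations\<close>

lemma free_word_induct [case_names zero add]:
  assumes "P 0" "\<And>g u. P u \<Longrightarrow> P (Word [g] + u)"
  shows "P u"
proof -
  have "P (Word ls)" for ls
  proof (induction ls)
    case Nil
    show ?case using assms(1) by (simp add: zero_free_word_def)
  next
    case (Cons g ls)
    then show ?case using assms(2)[of "Word ls" g] by (simp add: plus_free_word_def)
  qed
  then show ?thesis by (cases u) simp
qed

lemma free_algebra_induct [case_names scalar generator add mult]:
  fixes a :: "'g free_algebra"
  assumes "\<And>c. P (scalar c)" "\<And>g. P (generator g)" "\<And>a b. P a \<Longrightarrow> P b \<Longrightarrow> P (a + b)"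
    "\<And>a b. P a \<Longrightarrow> P b \<Longrightarrow> P (a * b)"
  shows "P a"
proof (induction a rule: poly_mapping_add_induct)
  case zero
  show ?case using assms(1)[of 0] by simp
next
  case (add u c a)
  have "P (Poly_Mapping.single u 1)"
  proof (induction u rule: free_word_induct)
    case zero
    show ?case by (rule assms(1))
  next
    case (add g u)
    have "Poly_Mapping.single (Word [g] + u) 1 = generator g * Poly_Mapping.single u (1::complex)"
      by (simp add: mult_single)
    then show ?case using assms(2,4) add by simp
  qed
  then have "P (scalar c * Poly_Mapping.single u 1)"
    by (rule assms(4)[OF assms(1)])
  then show ?case
    using assms(3) add by (simp add: mult_single)
qed

locale generator_operators = vector_space s
  for s :: "complex \<Rightarrow> 'w::ab_group_add \<Rightarrow> 'w" +
  fixes op :: "'g \<Rightarrow> 'w \<Rightarrow> 'w"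
  assumes linear_op: "Vector_Spaces.linear s s (op g)"
begin

definition rep :: "'g free_algebra \<Rightarrow> 'w \<Rightarrow> 'w"
  where "rep a w = lin_ext (\<lambda>u c. s c (foldr op (letters u) w)) a"

lemma rep_add: "rep (a + b) w = rep a w + rep b w"
  unfolding rep_def by (rule lin_ext_add) (simp_all add: scale_left_distrib)

lemma rep_single: "rep (Poly_Mapping.single u c) w = s c (foldr op (letters u) w)"
  by (simp add: rep_def)

lemma linear_foldr: "Vector_Spaces.linear s s (foldr op ls)"
proof (induction ls)
  case Nil
  show ?case using linear_id by (simp add: id_def)
next
  case (Cons g ls)
  then show ?case using Vector_Spaces.linear_compose[OF Cons linear_op] by (simp add: comp_def)
qed

lemma linear_rep: "Vector_Spaces.linear s s (rep a)"
proof -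
  interpret f: Vector_Spaces.linear s s "foldr op ls" for ls
    by (rule linear_foldr)
  have zero: "rep 0 w = 0" for w
    by (simp add: rep_def)
  show ?thesis
  proof unfold_locales
    show "rep a (v + w) = rep a v + rep a w" for v w
      by (induction a rule: poly_mapping_add_induct)
        (simp_all add: zero rep_add rep_single f.add scale_right_distrib)
    show "rep a (s c w) = s c (rep a w)" for c w
      by (induction a rule: poly_mapping_add_induct)
        (simp_all add: zero rep_add rep_single f.scale scale_right_distrib mult.commute)
  qed
qed

sublocale rep: Vector_Spaces.linear s s "rep a" for a
  by (rule linear_rep)

lemma rep_zero: "rep 0 w = 0"
  by (simp add: rep_def)

lemma rep_scalar: "rep (scalar c) w = s c w"
  by (simp add: rep_single zero_free_word_def)

lemma rep_one: "rep 1 w = w"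
  using rep_scalar[of 1 w] by simp

lemma rep_generator: "rep (generator g) w = op g w"
  by (simp add: rep_single)

lemma rep_mult: "rep (a * b) w = rep a (rep b w)"
proof -
  interpret f: Vector_Spaces.linear s s "foldr op ls" for ls
    by (rule linear_foldr)
  have "rep (Poly_Mapping.single u c * b) w = rep (Poly_Mapping.single u c) (rep b w)" for u c
    by (induction b rule: poly_mapping_add_induct)
      (simp_all add: rep_zero distrib_left rep_add rep.add rep.zero mult_single,
        simp_all add: rep_single plus_free_word_def f.scale)
  then show ?thesis
    by (induction a rule: poly_mapping_add_induct) (simp_all add: rep_zero distrib_right rep_add)
qed

lemma rep_diff: "rep (a - b) w = rep a w - rep b w"
  using rep_add[of "a - b" b w] by (simp add: algebra_simps)

lemma rep_sum: "rep (\<Sum>i\<in>I. a i) w = (\<Sum>i\<in>I. rep (a i) w)"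
  by (induction I rule: infinite_finite_induct) (simp_all add: rep_zero rep_add)

lemma rep_uminus: "rep (- a) w = - rep a w"
  using rep_diff[of 0 a w] by (simp add: rep_zero)

lemma rep_closed:
  assumes "\<And>c w. w \<in> Q \<Longrightarrow> s c w \<in> Q" "\<And>v w. v \<in> Q \<Longrightarrow> w \<in> Q \<Longrightarrow> v + w \<in> Q"
    and "\<And>g w. w \<in> Q \<Longrightarrow> op g w \<in> Q"
  shows "w \<in> Q \<Longrightarrow> rep a w \<in> Q"
  by (induction a arbitrary: w rule: free_algebra_induct)
    (simp_all add: rep_scalar rep_generator rep_add rep_mult assms)

lemma rep_commute:
  assumes "Vector_Spaces.linear s s L" and "\<And>g w. op g (L w) = L (op g w)"
  shows "rep a (L w) = L (rep a w)"
proof -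
  interpret L: Vector_Spaces.linear s s L by fact
  show ?thesis
    by (induction a arbitrary: w rule: free_algebra_induct)
      (simp_all add: rep_scalar rep_generator rep_add rep_mult assms L.scale L.add)
qed

text \<open>With this, vanishing on the defining relations passes to the whole ideal that they
  generate.\<close>

lemma ideal_annihilator: "ideal {a. \<forall>w. rep a w = 0} free_algebra_ring"
proof -
  interpret R: ring "free_algebra_ring :: 'g free_algebra ring"
    by (rule free_algebra_ring_is_ring)
  have inv: "\<ominus>\<^bsub>free_algebra_ring\<^esub> a = - a" for a :: "'g free_algebra"
    by (rule R.minus_equality) (simp_all add: free_algebra_ring_def)
  show ?thesis
  proof (rule idealI)
    show "subgroup {a. \<forall>w. rep a w = 0} (add_monoid free_algebra_ring)"
    proof (rule R.add.subgroupI, goal_cases)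
      case (3 a)
      then show ?case
        using inv[of a] by (simp add: a_inv_def rep_uminus)
    qed (auto simp: free_algebra_ring_def rep_zero rep_add intro: exI[of _ 0])
  qed (rule free_algebra_ring_is_ring, auto simp: free_algebra_ring_def rep_mult rep.zero)
qed

end

lemma ideal_cherednik: "ideal (cherednik_ideal \<kappa>) free_algebra_ring"
proof -
  interpret R: ring "free_algebra_ring :: 'a cherednik_gen free_algebra ring"
    by (rule free_algebra_ring_is_ring)
  show ?thesis
    unfolding cherednik_ideal_def by (rule R.genideal_ideal) (simp add: free_algebra_ring_def)
qed

lemma cherednik_class_hom: "cherednik_class \<kappa> \<in> ring_hom free_algebra_ring (cherednik_algebra \<kappa>)"
  using ideal.rcos_ring_hom[OF ideal_cherednik[of \<kappa>]]
  by (simp add: cherednik_class_def[abs_def] cherednik_algebra_def)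

lemma cherednik_class_mult:
  "cherednik_class \<kappa> a \<otimes>\<^bsub>cherednik_algebra \<kappa>\<^esub> cherednik_class \<kappa> b = cherednik_class \<kappa> (a * b)"
  using ring_hom_mult[OF cherednik_class_hom[of \<kappa>], of a b] by (simp add: free_algebra_ring_def)

lemma cherednik_class_add:
  "cherednik_class \<kappa> a \<oplus>\<^bsub>cherednik_algebra \<kappa>\<^esub> cherednik_class \<kappa> b = cherednik_class \<kappa> (a + b)"
  using ring_hom_add[OF cherednik_class_hom[of \<kappa>], of a b] by (simp add: free_algebra_ring_def)

lemma cherednik_class_one: "\<one>\<^bsub>cherednik_algebra \<kappa>\<^esub> = cherednik_class \<kappa> 1"
  using ring_hom_one[OF cherednik_class_hom[of \<kappa>], symmetric] by (simp add: free_algebra_ring_def)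

lemma cherednik_class_closed: "cherednik_class \<kappa> a \<in> carrier (cherednik_algebra \<kappa>)"
  using ring_hom_closed[OF cherednik_class_hom[of \<kappa>], of a] by (simp add: free_algebra_ring_def)

lemma carrier_cherednik_algebra: "c \<in> carrier (cherednik_algebra \<kappa>) \<Longrightarrow> \<exists>a. c = cherednik_class \<kappa> a"
  by (auto simp: cherednik_algebra_def cherednik_class_def FactRing_def A_RCOSETS_def')

lemma in_cherednik_class_iff: "b \<in> cherednik_class \<kappa> a \<longleftrightarrow> (\<exists>h\<in>cherednik_ideal \<kappa>. b = h + a)"
  by (auto simp: cherednik_class_def a_r_coset_def' free_algebra_ring_def)

locale cherednik_relations_hold = generator_operators s op
  for s :: "complex \<Rightarrow> 'w::ab_group_add \<Rightarrow> 'w" and op :: "'n::finite cherednik_gen \<Rightarrow> 'w \<Rightarrow> 'w" +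
  fixes \<kappa> :: complex
  assumes relations: "a \<in> cherednik_relations \<kappa> \<Longrightarrow> rep a w = 0"
begin

lemma rep_ideal: "a \<in> cherednik_ideal \<kappa> \<Longrightarrow> rep a w = 0"
proof -
  interpret R: ring "free_algebra_ring :: 'n cherednik_gen free_algebra ring"
    by (rule free_algebra_ring_is_ring)
  have "cherednik_ideal \<kappa> \<subseteq> {a. \<forall>w. rep a w = 0}"
    unfolding cherednik_ideal_def by (rule R.genideal_minimal[OF ideal_annihilator]) (auto simp: relations)
  then show "a \<in> cherednik_ideal \<kappa> \<Longrightarrow> rep a w = 0"
    by auto
qed

text \<open>The choice of a representative is harmless on cosets, because the ideal acts by
  zero.\<close>

definition quotient_rep :: "'n cherednik_gen free_algebra set \<Rightarrow> 'w \<Rightarrow> 'w"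
  where "quotient_rep c = rep (SOME a. a \<in> c)"

lemma quotient_rep_class: "quotient_rep (cherednik_class \<kappa> a) = rep a"
proof -
  have "0 \<in> cherednik_ideal \<kappa>"
    using additive_subgroup.zero_closed[OF ideal.axioms(1)[OF ideal_cherednik[of \<kappa>]]]
    by (simp add: free_algebra_ring_def)
  then have "a \<in> cherednik_class \<kappa> a"
    by (auto simp: in_cherednik_class_iff)
  then have "(SOME b. b \<in> cherednik_class \<kappa> a) \<in> cherednik_class \<kappa> a"
    by (rule someI)
  then show ?thesis
    by (auto simp: quotient_rep_def in_cherednik_class_iff rep_add rep_ideal)
qed

lemma cherednik_action_quotient_rep: "cherednik_action \<kappa> s quotient_rep"
  unfolding cherednik_action_def
proof (intro conjI ballI allI)
  show "Vector_Spaces.linear s s (quotient_rep c)" for c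
    unfolding quotient_rep_def by (rule linear_rep)
  show "quotient_rep \<one>\<^bsub>cherednik_algebra \<kappa>\<^esub> = id"
    by (rule ext) (simp add: cherednik_class_one quotient_rep_class rep_one)
  show "quotient_rep (cherednik_class \<kappa> (scalar a)) = s a" for a
    by (rule ext) (simp add: quotient_rep_class rep_scalar)
  fix c d :: "'n cherednik_gen free_algebra set"
  assume "c \<in> carrier (cherednik_algebra \<kappa>)" "d \<in> carrier (cherednik_algebra \<kappa>)"
  then obtain a b where [simp]: "c = cherednik_class \<kappa> a" "d = cherednik_class \<kappa> b"
    using carrier_cherednik_algebra by metis
  show "quotient_rep (c \<otimes>\<^bsub>cherednik_algebra \<kappa>\<^esub> d) = quotient_rep c \<circ> quotient_rep d"
    by (rule ext) (simp add: cherednik_class_mult quotient_rep_class rep_mult)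
  show "quotient_rep (c \<oplus>\<^bsub>cherednik_algebra \<kappa>\<^esub> d) = (\<lambda>w. quotient_rep c w + quotient_rep d w)"
    by (rule ext) (simp add: cherednik_class_add quotient_rep_class rep_add)
qed

text \<open>Every class has a representative in the free algebra, which is built from scalars and
  generators by sums and products.\<close>

lemma cherednik_action_unique:
  assumes "cherednik_action \<kappa> s \<rho>" "\<And>g. \<rho> (cherednik_class \<kappa> (generator g)) = op g"
    and "c \<in> carrier (cherednik_algebra \<kappa>)"
  shows "\<rho> c = quotient_rep c"
proof -
  have "\<rho> (cherednik_class \<kappa> a) = rep a" for a
  proof (induction a rule: free_algebra_induct)
    case (scalar c)
    then show ?case
      using assms(1) by (simp add: cherednik_action_def fun_eq_iff rep_scalar)
  next
    case (generator g)
    then show ?case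
      by (simp add: fun_eq_iff assms(2) rep_generator)
  next
    case (add a b)
    have "\<rho> (cherednik_class \<kappa> (a + b)) = (\<lambda>w. \<rho> (cherednik_class \<kappa> a) w + \<rho> (cherednik_class \<kappa> b) w)"
      using assms(1) cherednik_class_closed unfolding cherednik_action_def cherednik_class_add[symmetric] by blast
    then show ?case
      by (simp add: fun_eq_iff add rep_add)
  next
    case (mult a b)
    have "\<rho> (cherednik_class \<kappa> (a * b)) = \<rho> (cherednik_class \<kappa> a) \<circ> \<rho> (cherednik_class \<kappa> b)"
      using assms(1) cherednik_class_closed unfolding cherednik_action_def cherednik_class_mult[symmetric] by blast
    then show ?case
      by (simp add: fun_eq_iff mult rep_mult)
  qed
  moreover obtain a where "c = cherednik_class \<kappa> a"
    using carrier_cherednik_algebra[OF assms(3)] by blast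
  ultimately show ?thesis
    by (simp add: quotient_rep_class)
qed

end

section \<open>The action on W\<close>

context smooth_affine_module
begin

sublocale W: vector_space "pm_scale sc :: complex \<Rightarrow> ('n, 'm, 'v) W \<Rightarrow> _"
  by (rule vector_space_pm_scale[OF vector_space_axioms])

lemma linear_W_I:
  fixes L :: "('n, 'm, 'v) W \<Rightarrow> ('n, 'm, 'v) W"
  assumes "\<And>v w. L (v + w) = L v + L w"
    and "\<And>c w. L (X (Poly_Mapping.single 0 c) w) = X (Poly_Mapping.single 0 c) (L w)"
  shows "Vector_Spaces.linear (pm_scale sc) (pm_scale sc) L"
  by unfold_locales (simp_all add: assms flip: X_const)

lemma linear_X: "Vector_Spaces.linear (pm_scale sc) (pm_scale sc) (X f)"
  by (rule linear_W_I) (simp_all add: X.add X_mult mult.commute)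

lemma linear_S: "Vector_Spaces.linear (pm_scale sc) (pm_scale sc) (S \<sigma>)"
  by (rule linear_W_I) (simp_all add: S.add S_X)

abbreviation basis_act :: "'m affine_basis \<Rightarrow> ('n::finite, 'm, 'v) W \<Rightarrow> ('n, 'm, 'v) W"
  where "basis_act \<equiv> W_basis_act sc \<pi>"

lemma basis_act_add: "basis_act g (v + w) = basis_act g v + basis_act g w"
  by (cases g) (simp_all only: W_basis_act_Et W_basis_act_Cen Y.add F.add)

lemma basis_act_X: "basis_act g (X f w) = X f (basis_act g w)"
  by (cases g) (simp_all only: W_basis_act_Et W_basis_act_Cen Y_X F_X)

lemma S_basis_act: "S \<sigma> (basis_act g w) = basis_act g (S \<sigma> w)"
  by (cases g) (simp_all only: W_basis_act_Et W_basis_act_Cen S_Y S_F)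

lemma W_act_eq: "W_act sc \<pi> P w = (\<Sum>g\<in>Poly_Mapping.keys P. X (Poly_Mapping.single 0 (Poly_Mapping.lookup P g)) (basis_act g w))"
  by (simp add: W_act_def lin_ext_def X_const)

lemma W_act_add: "W_act sc \<pi> P (v + w) = W_act sc \<pi> P v + W_act sc \<pi> P w"
  by (simp add: W_act_eq basis_act_add X.add sum.distrib)

lemma W_act_X: "W_act sc \<pi> P (X f w) = X f (W_act sc \<pi> P w)"
  by (simp add: W_act_eq basis_act_X X.sum X_mult mult.commute)

lemma linear_W_act: "Vector_Spaces.linear (pm_scale sc) (pm_scale sc) (W_act sc \<pi> P)"
  by (rule linear_W_I) (simp_all add: W_act_add W_act_X)

lemma S_W_act: "S \<sigma> (W_act sc \<pi> P w) = W_act sc \<pi> P (S \<sigma> w)"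
  by (simp add: W_act_eq S.sum S_X S_basis_act)

lemma W_act_diff_left: "W_act sc \<pi> (P - P') w = W_act sc \<pi> P w - W_act sc \<pi> P' w"
proof -
  have "W_act sc \<pi> (P + P') w = W_act sc \<pi> P w + W_act sc \<pi> P' w" for P P'
    unfolding W_act_def by (rule lin_ext_add) (simp_all add: W.scale_left_distrib)
  from this[of "P - P'" P'] show ?thesis
    by (simp add: algebra_simps)
qed

lemma W_act_basis: "W_act sc \<pi> (basis_elt (Et c d n)) w = Y c d n w"
  by (simp add: W_act_eq W_basis_act_Et del: W_basis_act.simps)

section \<open>The subspace \<open>qW\<close> and trace cancellation\<close>

lemma W_act_in_qW: "P \<in> q_minus \<Longrightarrow> W_act sc \<pi> P w \<in> qW sc \<pi>"
  unfolding qW_def by (rule W.span_base) blast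

lemma qW_add: "v \<in> qW sc \<pi> \<Longrightarrow> w \<in> qW sc \<pi> \<Longrightarrow> v + w \<in> qW sc \<pi>"
  unfolding qW_def by (rule W.span_add)

lemma qW_diff: "v \<in> qW sc \<pi> \<Longrightarrow> w \<in> qW sc \<pi> \<Longrightarrow> v - w \<in> qW sc \<pi>"
  unfolding qW_def by (rule W.span_diff)

lemma qW_scale: "w \<in> qW sc \<pi> \<Longrightarrow> pm_scale sc c w \<in> qW sc \<pi>"
  unfolding qW_def by (rule W.span_scale)

lemma qW_sum: "(\<And>i. i \<in> I \<Longrightarrow> f i \<in> qW sc \<pi>) \<Longrightarrow> (\<Sum>i\<in>I. f i) \<in> qW sc \<pi>"
  unfolding qW_def by (rule W.span_sum)

lemma qW_invariant:
  fixes L :: "('n::finite, 'm, 'v) W \<Rightarrow> ('n, 'm, 'v) W"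
  assumes "Vector_Spaces.linear (pm_scale sc) (pm_scale sc) L"
    and "\<And>P w. P \<in> q_minus \<Longrightarrow> L (W_act sc \<pi> P w) \<in> qW sc \<pi>"
    and "w \<in> qW sc \<pi>"
  shows "L w \<in> qW sc \<pi>"
proof -
  interpret L: Vector_Spaces.linear "pm_scale sc" "pm_scale sc" L by fact
  from assms(3) show ?thesis
    unfolding qW_def
  proof (induction w rule: W.span_induct_alt)
    case base
    show ?case by (simp add: L.zero W.span_zero)
  next
    case (step c v w)
    then show ?case
      using assms(2) by (auto simp: L.add L.scale qW_def intro!: W.span_add W.span_scale)
  qed
qed

lemma X_qW: "w \<in> qW sc \<pi> \<Longrightarrow> X f w \<in> qW sc \<pi>"
  by (rule qW_invariant[OF linear_X]) (simp_all add: W_act_in_qW flip: W_act_X)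

lemma S_qW: "w \<in> qW sc \<pi> \<Longrightarrow> S \<sigma> w \<in> qW sc \<pi>"
  by (rule qW_invariant[OF linear_S]) (simp_all add: W_act_in_qW S_W_act)

lemma Y_offdiag_qW: "c \<noteq> d \<Longrightarrow> n < 0 \<Longrightarrow> Y c d n w \<in> qW sc \<pi>"
  unfolding W_act_basis[symmetric]
  by (rule W_act_in_qW) (auto simp: q_minus_def lookup_single when_def intro!: sum.neutral)

lemma Y_diag_qW:
  assumes "n < 0"
  shows "Y c c n w - Y d d n w \<in> qW sc \<pi>"
  unfolding W_act_basis[symmetric] W_act_diff_left[symmetric]
proof (rule W_act_in_qW)
  have "Poly_Mapping.keys (basis_elt (Et c c n) - basis_elt (Et d d n)) \<subseteq> {Et c c n, Et d d n}"
    by (auto simp: in_keys_iff lookup_minus lookup_single when_def split: if_splits)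
  moreover have "(\<Sum>a\<in>UNIV. Poly_Mapping.lookup (basis_elt (Et c c n) - basis_elt (Et d d n)) (Et a a j)) = 0" for j
    by (cases "j = n") (simp_all add: lookup_minus lookup_single when_def sum_subtractf)
  ultimately show "basis_elt (Et c c n) - basis_elt (Et d d n) \<in> q_minus"
    using assms by (auto simp: q_minus_def)
qed

lemma H_qW:
  assumes "n < 0"
  shows "H p c d n w \<in> qW sc \<pi>"
proof -
  \<comment> \<open>Diagonal units occur only for \<open>b = d\<close> and \<open>a = c\<close>.
    Both act on the same vector \<open>E c d p w\<close>, so their difference is an action of a
    traceless element.\<close>
  have "H p c d n w = (Y d d n (E c d p w) - Y c c n (E c d p w))
      + (\<Sum>b\<in>UNIV - {d}. Y b d n (E c b p w)) - (\<Sum>a\<in>UNIV - {c}. Y c a n (E a d p w))"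
    by (simp add: H_def sum.remove[of UNIV d "\<lambda>b. Y b d n (E c b p w)"] sum.remove[of UNIV c "\<lambda>a. Y c a n (E a d p w)"])
  then show ?thesis
    using assms by (auto intro!: qW_add qW_diff qW_sum Y_diag_qW Y_offdiag_qW)
qed

text \<open>Grouped by the power of \<open>t\<close>, the coefficients add up to traces. It is
  applied to \<open>f n = n x_p^n\<close>, the trace term of the commutator with
  \<open>z p\<close>.\<close>

lemma q_minus_trace:
  fixes f :: "int \<Rightarrow> 'n laurent"
  assumes "P \<in> q_minus"
  shows "(\<Sum>g\<in>Poly_Mapping.keys P. Poly_Mapping.single 0 (Poly_Mapping.lookup P g)
    * (case g of Et c d n \<Rightarrow> if c = d then f n else 0 | Cen \<Rightarrow> 0)) = 0"
proof -
  define \<phi> where "\<phi> g = Poly_Mapping.single 0 (Poly_Mapping.lookup P g)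
    * (case g of Et c d n \<Rightarrow> if c = d then f n else 0 | Cen \<Rightarrow> 0)" for g
  \<comment> \<open>\<open>J\<close> collects the powers of \<open>t\<close> in \<open>P\<close>.
    The sum over the keys is extended by zeros to all matrix units at these powers, so that complete
    traces appear.\<close>
  define J where "J = (\<lambda>g. case g of Et c d n \<Rightarrow> n | Cen \<Rightarrow> 0) ` Poly_Mapping.keys P"
  have J: "finite J"
    by (simp add: J_def)
  let ?e = "\<lambda>(n, c, d). Et c d n"
  have "sum \<phi> (Poly_Mapping.keys P) = sum \<phi> (?e ` (J \<times> UNIV))"
  proof (rule sum.mono_neutral_left)
    show "Poly_Mapping.keys P \<subseteq> ?e ` (J \<times> UNIV)"
    proof
      fix g
      assume g: "g \<in> Poly_Mapping.keys P"
      with assms obtain a b j where ab: "g = Et a b j"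
        by (auto simp: q_minus_def)
      with g have "j \<in> J"
        by (force simp: J_def)
      then show "g \<in> ?e ` (J \<times> UNIV)"
        by (intro image_eqI[of _ _ "(j, a, b)"]) (simp_all add: ab)
    qed
  qed (auto simp: J \<phi>_def in_keys_iff)
  also have "\<dots> = (\<Sum>x\<in>J \<times> UNIV. \<phi> (?e x))"
    by (subst sum.reindex) (auto simp: inj_on_def)
  also have "\<dots> = (\<Sum>n\<in>J. \<Sum>(c, d)\<in>UNIV. \<phi> (Et c d n))"
    by (simp add: sum.cartesian_product case_prod_unfold)
  also have "\<dots> = (\<Sum>n\<in>J. \<Sum>c\<in>UNIV. Poly_Mapping.single 0 (Poly_Mapping.lookup P (Et c c n)) * f n)"
    by (simp add: sum_UNIV_pair \<phi>_def if_distrib cong: if_cong)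
  also have "\<dots> = (\<Sum>n\<in>J. Poly_Mapping.single 0 (\<Sum>c\<in>UNIV. Poly_Mapping.lookup P (Et c c n)) * f n)"
  proof (rule sum.cong)
    have "Poly_Mapping.single 0 (\<Sum>c\<in>I. Poly_Mapping.lookup P (Et c c n)) =
        (\<Sum>c\<in>I. Poly_Mapping.single (0 :: 'n \<Rightarrow>\<^sub>0 int) (Poly_Mapping.lookup P (Et c c n)))" for n I
      by (induction I rule: infinite_finite_induct) (simp_all add: single_add)
    then show "(\<Sum>c\<in>UNIV. Poly_Mapping.single 0 (Poly_Mapping.lookup P (Et c c n)) * f n) =
        Poly_Mapping.single 0 (\<Sum>c\<in>UNIV. Poly_Mapping.lookup P (Et c c n)) * f n" for n
      by (simp add: sum_distrib_right)
  qed simp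
  also have "\<dots> = 0"
    using assms by (simp add: q_minus_def)
  finally show ?thesis
    by (simp add: \<phi>_def)
qed

end

section \<open>Equivariance and invariance under \<open>z p\<close>\<close>

context cherednik_operators
begin

lemma linear_z: "Vector_Spaces.linear (pm_scale sc) (pm_scale sc) (z p)"
  by (rule linear_W_I) (simp_all add: z.add z_const)

lemma z_gl_finite:
  assumes "P \<in> gl_finite"
  shows "z p (W_act sc \<pi> P w) = W_act sc \<pi> P (z p w)"
proof -
  have Y: "z p (Y c d 0 w) = Y c d 0 (z p w)" for c d w
  proof -
    \<comment> \<open>For \<open>j = 0\<close> the sum in \<open>zY_defect_flat\<close> is empty and
      the other term has the factor \<open>j\<close>.\<close>
    have "zY_defect p c d 0 w = 0"
      by (induction w rule: spanned_by_flat)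
        (simp_all add: zY_defect_X zY_defect_flat X_left.zero, simp add: zY_defect_def Y.add z.add)
    then show ?thesis
      by (simp add: zY_defect_def)
  qed
  have "z p (basis_act g w) = basis_act g (z p w)" if "g \<in> Poly_Mapping.keys P" for g
    using that assms by (auto simp: gl_finite_def W_basis_act_Et Y simp del: W_basis_act.simps)
  then show ?thesis
    by (simp add: W_act_eq z.sum z_const)
qed

text \<open>It suffices that the commutator \<open>K\<close> of \<open>z p\<close> with each
  \<open>P\<close> maps W into \<open>qW\<close>; since \<open>K\<close> commutes with
  multiplication and \<open>qW\<close> is stable under it, flat vectors are enough.\<close>

lemma z_qW:
  assumes level: "\<And>v. \<pi> (basis_elt Cen) v = sc (\<kappa> - of_nat CARD('m)) v"
    and "w \<in> qW sc \<pi>"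
  shows "z p w \<in> qW sc \<pi>"
proof (rule qW_invariant[OF linear_z _ assms(2)])
  fix P :: "'m affine_gl" and w :: "('a, 'm, 'v) W"
  assume P: "P \<in> q_minus"
  define K where "K w = z p (W_act sc \<pi> P w) - W_act sc \<pi> P (z p w)" for w
  have "F Cen w = X (Poly_Mapping.single 0 (\<kappa> - of_nat CARD('m))) w" for w :: "('a, 'm, 'v) W"
    by (induction w rule: W_induct) (simp_all add: F.add X.add F_single X_single level)
  then have Cen: "F Cen w = X (Poly_Mapping.single 0 \<kappa>) w - X (of_nat CARD('m)) w" for w :: "('a, 'm, 'v) W"
    by (simp add: single_diff X_left.diff)
  have K_flat: "K u \<in> qW sc \<pi>" if "flat u" for u
  proof -
    \<comment> \<open>What \<open>zY_defect_flat\<close> leaves modulo \<open>qW\<close> at level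
      \<open>\<kappa> - m\<close>: the multiples of \<open>E c d p u\<close> cancel, and the trace
      term has the factor \<open>- j = n\<close>.\<close>
    define \<psi> where "\<psi> g = (case g of Et c d n \<Rightarrow> if c = d then of_int n * xpow p n else 0 | Cen \<Rightarrow> 0)" for g :: "'m affine_basis"
    have basis: "z p (basis_act g u) - basis_act g (z p u) - X (\<psi> g) u \<in> qW sc \<pi>"
      if "g \<in> Poly_Mapping.keys P" for g
    proof -
      have "g \<in> {Et a b j |a b j. j \<le> - 1}"
        using that P by (auto simp: q_minus_def)
      then obtain c d n where g: "g = Et c d n" "n \<le> -1"
        by blast
      define j where "j = nat (- n)"
      have n: "n = - int j"
        using g by (simp add: j_def)
      have "z p (basis_act g u) - basis_act g (z p u) - X (\<psi> g) u =
          (\<Sum>i<j. X (xpow p (- int i)) (H p c d (int i - int j) u))"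
        using zY_defect_flat[OF \<open>flat u\<close>, of p c d j]
        by (simp add: g(1) W_basis_act_Et n zY_defect_def \<psi>_def Cen E.diff E_X X.minus X_left.minus X_left.zero del: W_basis_act.simps)
      \<comment> \<open>The degree \<open>i - j\<close> is negative because \<open>i < j\<close>, as
        \<open>H_qW\<close> requires.\<close>
      also have "\<dots> \<in> qW sc \<pi>"
        by (auto intro!: qW_sum X_qW H_qW)
      finally show ?thesis .
    qed
    let ?c = "\<lambda>g. Poly_Mapping.single 0 (Poly_Mapping.lookup P g)"
    have "K u = (\<Sum>g\<in>Poly_Mapping.keys P. X (?c g) (z p (basis_act g u) - basis_act g (z p u)))"
      by (simp add: K_def W_act_eq z.sum z_const X.diff sum_subtractf)
    also have "\<dots> = (\<Sum>g\<in>Poly_Mapping.keys P. X (?c g) (z p (basis_act g u) - basis_act g (z p u) - X (\<psi> g) u))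
        + X (\<Sum>g\<in>Poly_Mapping.keys P. ?c g * \<psi> g) u"
      by (simp add: X.diff sum_subtractf X_left.sum X_mult)
    also have "(\<Sum>g\<in>Poly_Mapping.keys P. ?c g * \<psi> g) = 0"
      unfolding \<psi>_def by (rule q_minus_trace[OF P])
    finally show ?thesis
      by (auto simp: X_left.zero intro!: qW_sum X_qW basis)
  qed
  have K_X: "K (X f w) = X f (K w)" for f w
  proof (rule commute_X)
    show "Modules.additive K"
      by unfold_locales (simp add: K_def W_act_add z.add)
    show "K (X (Poly_Mapping.single 0 c) w) = X (Poly_Mapping.single 0 c) (K w)" for c w
      by (simp add: K_def W_act_X z_const X.diff)
    interpret L: Vector_Spaces.linear "pm_scale sc" "pm_scale sc" "W_act sc \<pi> P"
      by (rule linear_W_act)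
    show "K (X (xpow r 1) w) = X (xpow r 1) (K w)" for r w
      by (cases "r = p") (simp_all add: K_def z_xpow W_act_X S_W_act L.add L.diff L.sum X.diff)
  qed
  have "K w \<in> qW sc \<pi>"
  proof (induction w rule: spanned_by_flat)
    case (add x y)
    have "K (x + y) = K x + K y"
      by (simp add: K_def W_act_add z.add)
    with add show ?case by (simp add: qW_add)
  qed (simp add: K_X X_qW K_flat)
  then have "K w + W_act sc \<pi> P (z p w) \<in> qW sc \<pi>"
    by (intro qW_add W_act_in_qW P)
  then show "z p (W_act sc \<pi> P w) \<in> qW sc \<pi>"
    by (simp add: K_def)
qed

fun gen_operator :: "'n::finite cherednik_gen \<Rightarrow> ('n, 'm, 'v) W \<Rightarrow> ('n, 'm, 'v) W"
  where
    "gen_operator (Gen_x p) = X (xpow p 1)"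
  | "gen_operator (Gen_xinv p) = X (xpow p (- 1))"
  | "gen_operator (Gen_s \<sigma>) = S \<sigma>"
  | "gen_operator (Gen_z p) = z p"

sublocale gen: generator_operators "pm_scale sc :: complex \<Rightarrow> ('n::finite, 'm, 'v) W \<Rightarrow> _" gen_operator
proof (intro generator_operators.intro generator_operators_axioms.intro W.vector_space_axioms)
  show "Vector_Spaces.linear (pm_scale sc) (pm_scale sc) (gen_operator g)" for g :: "'n cherednik_gen"
    by (cases g) (simp_all add: linear_X linear_S linear_z)
qed

sublocale gen: cherednik_relations_hold "pm_scale sc :: complex \<Rightarrow> ('n::finite, 'm, 'v) W \<Rightarrow> _" gen_operator \<kappa>
proof
  fix a :: "'n cherednik_gen free_algebra" and w :: "('n, 'm, 'v) W"
  note reps = gen.rep_diff gen.rep_add gen.rep_sum gen.rep_uminus gen.rep_mult gen.rep_generator gen.rep_one gen.rep_scalar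
  assume "a \<in> cherednik_relations \<kappa>"
  then show "gen.rep a w = 0"
    unfolding cherednik_relations_def
    by (auto simp: reps z_commutator z_xpow S_X S_z S_mult X_mult xpow_mult xpow_zero mult.commute X.diff X.sum
        simp flip: X_const)
qed

end

theorem proposition2p3:
  fixes \<kappa> :: complex
    and sc :: "complex \<Rightarrow> 'v \<Rightarrow> 'v::ab_group_add"
    and \<pi> :: "'m::finite affine_gl \<Rightarrow> 'v \<Rightarrow> 'v"
  assumes "affine_module sc \<pi>"
    and "\<forall>v. \<exists>i. \<forall>Y \<in> gl_degree_ge i. \<pi> Y v = 0"
  shows
    "(\<forall>(p::'n::finite) (w::('n, 'm, 'v) W). finite {i. z_summand sc \<pi> p i w \<noteq> 0}) \<and>
     (\<exists>\<rho> :: 'n cherednik_gen free_algebra set \<Rightarrow> ('n, 'm, 'v) W \<Rightarrow> ('n, 'm, 'v) W.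
       prescribed_action \<kappa> sc \<pi> \<rho> \<and>
       (\<forall>\<rho>'. prescribed_action \<kappa> sc \<pi> \<rho>' \<longrightarrow>
         (\<forall>c \<in> carrier (cherednik_algebra \<kappa>). \<rho>' c = \<rho> c)) \<and>
       (\<forall>c \<in> carrier (cherednik_algebra \<kappa>). \<forall>Y \<in> gl_finite. \<forall>w.
         \<rho> c (W_act sc \<pi> Y w) = W_act sc \<pi> Y (\<rho> c w)) \<and>
       ((\<forall>v. \<pi> (basis_elt Cen) v = sc (\<kappa> - of_nat CARD('m)) v) \<longrightarrow>
         (\<forall>c \<in> carrier (cherednik_algebra \<kappa>). \<forall>w \<in> qW sc \<pi>. \<rho> c w \<in> qW sc \<pi>)))"
proof -
  interpret cherednik_operators sc \<pi> \<kappa>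
    by unfold_locales (use assms in auto)
  let ?\<rho> = "gen.quotient_rep :: 'n cherednik_gen free_algebra set \<Rightarrow> ('n, 'm, 'v) W \<Rightarrow> ('n, 'm, 'v) W"
  have prescribed: "prescribed_action \<kappa> sc \<pi> \<rho> \<longleftrightarrow> cherednik_action \<kappa> (pm_scale sc) \<rho> \<and>
      (\<forall>g. \<rho> (cherednik_class \<kappa> (generator g)) = gen_operator g)"
    for \<rho> :: "'n cherednik_gen free_algebra set \<Rightarrow> ('n, 'm, 'v) W \<Rightarrow> ('n, 'm, 'v) W"
  proof -
    have "(\<forall>g. \<rho> (cherednik_class \<kappa> (generator g)) = gen_operator g) \<longleftrightarrow>
       (\<forall>p. \<rho> (cherednik_class \<kappa> (gx p)) = gen_operator (Gen_x p)) \<and>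
       (\<forall>p. \<rho> (cherednik_class \<kappa> (gxi p)) = gen_operator (Gen_xinv p)) \<and>
       (\<forall>\<sigma>. \<rho> (cherednik_class \<kappa> (gs \<sigma>)) = gen_operator (Gen_s \<sigma>)) \<and>
       (\<forall>p. \<rho> (cherednik_class \<kappa> (gz p)) = gen_operator (Gen_z p))"
      by (metis cherednik_gen.exhaust)
    then show ?thesis
      unfolding prescribed_action_def z_operator_eq by (simp add: X_def S_def)
  qed
  show ?thesis
  proof (intro conjI exI[of _ ?\<rho>] allI ballI impI)
    show "finite {i. z_summand sc \<pi> p i w \<noteq> 0}" for p :: 'n and w :: "('n, 'm, 'v) W"
      by (simp add: z_summand_eq finite_A)
    show "prescribed_action \<kappa> sc \<pi> ?\<rho>"
      unfolding prescribed
      by (simp add: gen.cherednik_action_quotient_rep gen.quotient_rep_class gen.rep_generator fun_eq_iff)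
    show "\<rho>' c = ?\<rho> c" if "prescribed_action \<kappa> sc \<pi> \<rho>'" "c \<in> carrier (cherednik_algebra \<kappa>)" 
      for \<rho>' :: "'n cherednik_gen free_algebra set \<Rightarrow> ('n, 'm, 'v) W \<Rightarrow> ('n, 'm, 'v) W" and c
      using that gen.cherednik_action_unique unfolding prescribed by blast
  next
    fix c :: "'n cherednik_gen free_algebra set" and Y :: "'m affine_gl" and w :: "('n, 'm, 'v) W"
    assume "c \<in> carrier (cherednik_algebra \<kappa>)" and Y: "Y \<in> gl_finite"
    then obtain a where c: "c = cherednik_class \<kappa> a"
      using carrier_cherednik_algebra by blast
    \<comment> \<open>Variables and permutations commute with the whole affine action; degree zero
      matters for \<open>z p\<close>.\<close>
    have "gen_operator g (W_act sc \<pi> Y w) = W_act sc \<pi> Y (gen_operator g w)" for g :: "'n cherednik_gen" and w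
      using Y by (cases g) (simp_all add: W_act_X S_W_act z_gl_finite)
    then show "?\<rho> c (W_act sc \<pi> Y w) = W_act sc \<pi> Y (?\<rho> c w)"
      unfolding c gen.quotient_rep_class by (rule gen.rep_commute[OF linear_W_act])
  next
    fix c :: "'n cherednik_gen free_algebra set" and w :: "('n, 'm, 'v) W"
    assume level: "\<forall>v. \<pi> (basis_elt Cen) v = sc (\<kappa> - of_nat CARD('m)) v"
      and "c \<in> carrier (cherednik_algebra \<kappa>)" and w: "w \<in> qW sc \<pi>"
    then obtain a where c: "c = cherednik_class \<kappa> a"
      using carrier_cherednik_algebra by blast
    have "gen_operator g w \<in> qW sc \<pi>" if "w \<in> qW sc \<pi>" for g :: "'n cherednik_gen" and w
      using that level by (cases g) (simp_all add: X_qW S_qW z_qW)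
    then show "?\<rho> c w \<in> qW sc \<pi>"
      unfolding c gen.quotient_rep_class using w by (intro gen.rep_closed qW_scale qW_add)
  qed
qed

end
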